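(* There is a constant $c(p,\gamma)<\infty$, independent of $N$ and of $k$, such that for all $N\ge2$ and all $k\in\{1,\ldots,N-1\}$, with $\bar x=(k-\tfrac12)p\ell^2/R$, $$P_N\bigl(K(\bar x;z_1,\ldots,z_N)=0\bigr)\ge 1/c(p,\gamma)>0 .$$
   Context: Setting. Let $R,\ell>0$, $p\in\mathbb{N}$ and $\gamma=\ell/R$. $\mathcal{Z}=\mathbb{R}\times[0,2\pi R]$, with $z=x+iy$. Laughlin's function. $$\Psi_N(z_1,\ldots,z_N)=\kappa_N\prod_{j<k}\bigl(e^{z_k/R}-e^{z_j/R}\bigr)^p\exp\Bigl(-\frac{1}{2\ell^2}\sum_k x_k^2\Bigr),$$ with $\kappa_N>0$. Probability measure. $P_N$ is the probability measure on $\mathcal{Z}^N$ with density proportional to $|\Psi_N(z_1,\ldots,z_N)|^2$. Particle excess function. For $\bar x=(k-\tfrac12)p\ell^2/R$ with $k\in\{1,\ldots,N-1\}$, $$K(\bar x;z_1,\ldots,z_N)=\#\{j:x_j\le\bar x\}-k .$$ *)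

theory Defs
  imports "HOL-Analysis.Analysis"
begin

definition cyl :: "real \<Rightarrow> complex set" where
  "cyl R = {z. 0 \<le> Im z \<and> Im z \<le> 2 * pi * R}"

definition cyl_measure :: "real \<Rightarrow> complex measure" where
  "cyl_measure R = restrict_space lborel (cyl R)"

text \<open>Laughlin's function (with the normalisation constant kappa_N taken as 1; it
  cancels in the probability measure). Particles are indexed 0..N-1.\<close>
definition laughlin_Psi :: "nat \<Rightarrow> real \<Rightarrow> real \<Rightarrow> nat \<Rightarrow> (nat \<Rightarrow> complex) \<Rightarrow> complex" where
  "laughlin_Psi p R l N z =
     (\<Prod>k<N. \<Prod>j<k. (exp (z k / of_real R) - exp (z j / of_real R)) ^ p)
     * of_real (exp (- (1 / (2 * l\<^sup>2)) * (\<Sum>k<N. (Re (z k))\<^sup>2)))"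

definition config_measure :: "real \<Rightarrow> nat \<Rightarrow> (nat \<Rightarrow> complex) measure" where
  "config_measure R N = PiM {..<N} (\<lambda>_. cyl_measure R)"

definition laughlin_prob :: "nat \<Rightarrow> real \<Rightarrow> real \<Rightarrow> nat \<Rightarrow> (nat \<Rightarrow> complex) measure" where
  "laughlin_prob p R l N =
     density (config_measure R N)
       (\<lambda>z. ennreal ((cmod (laughlin_Psi p R l N z))\<^sup>2)
            / (\<integral>\<^sup>+ w. ennreal ((cmod (laughlin_Psi p R l N w))\<^sup>2) \<partial>config_measure R N))"

definition particle_excess :: "nat \<Rightarrow> nat \<Rightarrow> real \<Rightarrow> (nat \<Rightarrow> complex) \<Rightarrow> int" where
  "particle_excess N k xbar z = int (card {j \<in> {..<N}. Re (z j) \<le> xbar}) - int k"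

end

theory Submission
  imports Defs "HOL-Probability.Distributions" "HOL-Real_Asymp.Real_Asymp"
begin

text \<open>
  Write \<open>X\<^sub>i = exp (z\<^sub>i / R)\<close> and \<open>\<gamma> = l / R\<close>. The density is \<open>|F(X)|\<^sup>2\<close> times a Gaussian in the
  real parts, with \<open>F\<close> a polynomial. Integrating out the angles makes distinct monomials orthogonal,
  so that the rescaled real parts become a mixture, over the exponents \<open>m\<close> of \<open>F\<close>, of independent
  Gaussians of variance \<open>\<gamma>\<^sup>2 / 2\<close> centred at \<open>m\<^sub>i \<gamma>\<^sup>2\<close>.

  Split the particles into a set \<open>I\<close> of size \<open>k\<close> and its complement \<open>J\<close>, and let \<open>G\<close> be the part of
  \<open>F\<close> of lowest degree in the variables \<open>X\<^sub>i\<close>, \<open>i \<in> I\<close>: up to sign it is the product of the two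
  separate Laughlin polynomials and of \<open>X\<^sub>j\<close> to the power \<open>p k\<close> for \<open>j \<in> J\<close>. Its exponents are
  constrained: the \<open>r\<close>-th one of \<open>I\<close> (of \<open>J\<close>), counted from the cut at \<open>(k - 1/2) p \<gamma>\<^sup>2\<close>, is centred
  at distance at least \<open>r p \<gamma>\<^sup>2 / 2\<close> to the left (right) of the cut. Hence in the ensemble of \<open>|G|\<^sup>2\<close>
  the event that \<open>I\<close> lies left and \<open>J\<close> right of the cut has a probability bounded below by a
  convergent product, and

  \<^item> on this event, rotating \<open>I\<close> jointly around the cylinder and using that the mean of \<open>|P|\<^sup>2\<close> over
    a circle is at least \<open>|P(0)|\<^sup>2\<close>, the integral of \<open>|F|\<^sup>2\<close> dominates that of \<open>|G|\<^sup>2\<close>;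
  \<^item> where all of \<open>I\<close> lies left of all of \<open>J\<close>, one has \<open>|F|\<^sup>2 \<le> |G|\<^sup>2 exp (2 p \<Sum> |X\<^sub>i / X\<^sub>j|)\<close>, and
    the exponential has bounded mean in the ensemble of \<open>|G|\<^sup>2\<close>.

  Summing over \<open>I\<close> compares the partition function with the weight of \<open>K = 0\<close>.
\<close>

section \<open>Measure on the cylinder and rotations\<close>

lemma lborel_complex_eq_distr:
  "(lborel :: complex measure) = distr (lborel \<Otimes>\<^sub>M lborel) borel (\<lambda>(x, y). Complex x y)"
proof (rule lborel_eqI)
  have meas: "(\<lambda>(x, y). Complex x y) \<in> borel_measurable (lborel \<Otimes>\<^sub>M lborel)"
    by (simp add: Complex_eq split_def)
  fix l u :: complex
  assume le: "\<And>b. b \<in> Basis \<Longrightarrow> l \<bullet> b \<le> u \<bullet> b"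
  have le': "Re l \<le> Re u" "Im l \<le> Im u"
    using le[of 1] le[of \<i>] by (auto simp: Basis_complex_def)
  have pre: "(\<lambda>(x, y). Complex x y) -` box l u \<inter> space (lborel \<Otimes>\<^sub>M lborel)
      = {Re l<..<Re u} \<times> {Im l<..<Im u}"
    by (auto simp: box_def Basis_complex_def space_pair_measure)
  show "emeasure (distr (lborel \<Otimes>\<^sub>M lborel) borel (\<lambda>(x, y). Complex x y)) (box l u)
      = (\<Prod>b\<in>Basis. (u - l) \<bullet> b)"
    using le' by (simp add: emeasure_distr[OF meas] pre lborel.emeasure_pair_measure_Times
        Basis_complex_def ennreal_mult)
qed simp

lemma cyl_measurable [measurable]: "cyl R \<in> sets borel"
  unfolding cyl_def by measurable

lemma space_cyl_measure: "space (cyl_measure R) = cyl R"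
  by (simp add: cyl_measure_def space_restrict_space)

lemma sets_cyl_measure: "sets (cyl_measure R) = sets (restrict_space borel (cyl R))"
  unfolding cyl_measure_def by (intro sets_restrict_space_cong) simp

lemma product_sigma_finite_cyl: "product_sigma_finite (\<lambda>_. cyl_measure R)"
  unfolding product_sigma_finite_def cyl_measure_def
  by (intro allI sigma_finite_measure_restrict_space) (simp_all add: sigma_finite_lborel)

lemma measurable_cyl_measure_borel:
  "f \<in> borel_measurable borel \<Longrightarrow> f \<in> borel_measurable (cyl_measure R)"
  unfolding cyl_measure_def by (intro measurable_restrict_space1) simp

lemma measurable_config_component [measurable (raw)]:
  assumes "i \<in> U"
  shows "(\<lambda>z. z i) \<in> borel_measurable (PiM U (\<lambda>_. cyl_measure R))"
  using measurable_compose[OF measurable_component_singleton[OF assms, of "\<lambda>_. cyl_measure R"]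
      measurable_cyl_measure_borel[of "\<lambda>z::complex. z" R]] by simp

lemma nn_integral_cyl_measure:
  assumes [measurable]: "f \<in> borel_measurable borel"
  shows "(\<integral>\<^sup>+z. f z \<partial>cyl_measure R)
    = (\<integral>\<^sup>+x. \<integral>\<^sup>+y. f (Complex x y) * indicator {0..2 * pi * R} y \<partial>lborel \<partial>lborel)"
proof -
  have [measurable]: "(\<lambda>x. Complex (fst x) (snd x)) \<in> borel_measurable (lborel \<Otimes>\<^sub>M lborel)"
    by (simp add: Complex_eq)
  have "(\<integral>\<^sup>+z. f z \<partial>cyl_measure R) = (\<integral>\<^sup>+z. f z * indicator (cyl R) z \<partial>lborel)"
    unfolding cyl_measure_def by (subst nn_integral_restrict_space) auto
  also have "\<dots>
      = (\<integral>\<^sup>+(x, y). f (Complex x y) * indicator (cyl R) (Complex x y) \<partial>(lborel \<Otimes>\<^sub>M lborel))"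
    by (subst lborel_complex_eq_distr, subst nn_integral_distr) (auto simp: split_def)
  also have "\<dots> = (\<integral>\<^sup>+x. \<integral>\<^sup>+y. f (Complex x y) * indicator (cyl R) (Complex x y) \<partial>lborel \<partial>lborel)"
    by (subst lborel.nn_integral_fst[symmetric]) (auto simp: split_def)
  finally show ?thesis by (simp add: cyl_def indicator_def)
qed

lemma nn_integral_cyl_measure_Re:
  assumes [measurable]: "g \<in> borel_measurable borel" and "R > 0"
  shows "(\<integral>\<^sup>+z. g (Re z) \<partial>cyl_measure R) = ennreal (2 * pi * R) * (\<integral>\<^sup>+x. g x \<partial>lborel)"
  using assms(2)
  by (simp add: nn_integral_cyl_measure nn_integral_cmult nn_integral_multc mult.commute)

definition rotate_cyl :: "real \<Rightarrow> real \<Rightarrow> complex \<Rightarrow> complex" where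
  "rotate_cyl R \<theta> z = Complex (Re z)
     (if Im z + \<theta> \<le> 2 * pi * R then Im z + \<theta> else Im z + \<theta> - 2 * pi * R)"

lemma Re_rotate_cyl [simp]: "Re (rotate_cyl R \<theta> z) = Re z"
  by (simp add: rotate_cyl_def)

lemma rotate_cyl_in_cyl:
  "0 \<le> \<theta> \<Longrightarrow> \<theta> \<le> 2 * pi * R \<Longrightarrow> z \<in> cyl R \<Longrightarrow> rotate_cyl R \<theta> z \<in> cyl R"
  unfolding rotate_cyl_def cyl_def
  by (cases "Im z + \<theta> \<le> 2 * pi * R") (auto simp: algebra_simps)

lemma exp_rotate_cyl:
  assumes "R > 0"
  shows "exp (rotate_cyl R \<theta> z / of_real R) = cis (\<theta> / R) * exp (z / of_real R)"
proof -
  have "exp (Complex (Re z) (Im z + \<theta> - 2 * pi * R) / of_real R)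
      = exp (z / of_real R + \<i> * of_real (\<theta> / R) - 2 * of_real pi * \<i>)"
    using assms by (intro arg_cong[of _ _ exp]) (auto simp: complex_eq_iff field_simps)
  moreover have "exp (Complex (Re z) (Im z + \<theta>) / of_real R)
      = exp (z / of_real R + \<i> * of_real (\<theta> / R))"
    using assms by (intro arg_cong[of _ _ exp]) (auto simp: complex_eq_iff field_simps)
  ultimately show ?thesis
    by (simp add: rotate_cyl_def cis_conv_exp exp_add exp_diff)
qed

lemma rotate_cyl_measurable_borel [measurable]: "rotate_cyl R \<theta> \<in> borel_measurable borel"
  unfolding rotate_cyl_def Complex_eq by measurable

lemma nn_integral_rotate_interval:
  fixes g :: "real \<Rightarrow> ennreal"
  assumes [measurable]: "g \<in> borel_measurable borel" and "0 \<le> \<theta>" "\<theta> \<le> L"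
  shows "(\<integral>\<^sup>+y. g (if y + \<theta> \<le> L then y + \<theta> else y + \<theta> - L) * indicator {0..L} y \<partial>lborel)
    = (\<integral>\<^sup>+y. g y * indicator {0..L} y \<partial>lborel)"
proof -
  have "(\<integral>\<^sup>+y. g (if y + \<theta> \<le> L then y + \<theta> else y + \<theta> - L) * indicator {0..L} y \<partial>lborel)
      = (\<integral>\<^sup>+y. g (y + \<theta>) * indicator {\<theta>..L} (y + \<theta>)
            + g (y + (\<theta> - L)) * indicator {0<..\<theta>} (y + (\<theta> - L)) \<partial>lborel)"
    using assms by (intro nn_integral_cong) (auto simp: indicator_def algebra_simps)
  also have "\<dots> = (\<integral>\<^sup>+y. g (y + \<theta>) * indicator {\<theta>..L} (y + \<theta>) \<partial>lborel)
      + (\<integral>\<^sup>+y. g (y + (\<theta> - L)) * indicator {0<..\<theta>} (y + (\<theta> - L)) \<partial>lborel)"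
    by (intro nn_integral_add) auto
  also have "\<dots>
      = (\<integral>\<^sup>+y. g y * indicator {\<theta>..L} y \<partial>lborel) + (\<integral>\<^sup>+y. g y * indicator {0<..\<theta>} y \<partial>lborel)"
    using nn_integral_real_affine[of "\<lambda>y. g y * indicator {\<theta>..L} y" 1 \<theta>]
      nn_integral_real_affine[of "\<lambda>y. g y * indicator {0<..\<theta>} y" 1 "\<theta> - L"]
    by (simp add: add.commute)
  also have "\<dots> = (\<integral>\<^sup>+y. g y * indicator {\<theta>..L} y + g y * indicator {0<..\<theta>} y \<partial>lborel)"
    by (intro nn_integral_add[symmetric]) auto
  also have "\<dots> = (\<integral>\<^sup>+y. g y * indicator {0..L} y \<partial>lborel)"
  proof (rule nn_integral_cong_AE)
    have "AE y in lborel. y \<noteq> 0 \<and> y \<noteq> \<theta>"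
      using AE_lborel_singleton[of "0::real"] AE_lborel_singleton[of \<theta>] by eventually_elim auto
    then show "AE y in lborel. g y * indicator {\<theta>..L} y + g y * indicator {0<..\<theta>} y
        = g y * indicator {0..L} y"
      by eventually_elim (use assms in \<open>auto simp: indicator_def\<close>)
  qed
  finally show ?thesis .
qed

lemma nn_integral_rotate_cyl:
  assumes [measurable]: "f \<in> borel_measurable borel" and \<theta>: "0 \<le> \<theta>" "\<theta> \<le> 2 * pi * R"
  shows "(\<integral>\<^sup>+z. f (rotate_cyl R \<theta> z) \<partial>cyl_measure R) = (\<integral>\<^sup>+z. f z \<partial>cyl_measure R)"
proof -
  have "(\<integral>\<^sup>+y. f (rotate_cyl R \<theta> (Complex x y)) * indicator {0..2 * pi * R} y \<partial>lborel)
      = (\<integral>\<^sup>+y. f (Complex x y) * indicator {0..2 * pi * R} y \<partial>lborel)" for x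
  proof -
    have "(\<lambda>y. Complex x y) \<in> borel_measurable borel" by (simp add: Complex_eq)
    then have "(\<lambda>y. f (Complex x y)) \<in> borel_measurable borel" by measurable
    from nn_integral_rotate_interval[OF this \<theta>] show ?thesis
      by (simp add: rotate_cyl_def cong: if_cong)
  qed
  then show ?thesis by (simp add: nn_integral_cyl_measure)
qed

lemma rotate_cyl_measurable:
  assumes "0 \<le> \<theta>" "\<theta> \<le> 2 * pi * R"
  shows "rotate_cyl R \<theta> \<in> cyl_measure R \<rightarrow>\<^sub>M cyl_measure R"
proof -
  have "rotate_cyl R \<theta> \<in> cyl_measure R \<rightarrow>\<^sub>M restrict_space borel (cyl R)"
    using rotate_cyl_in_cyl[OF assms]
    by (intro measurable_restrict_space2 measurable_cyl_measure_borel)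
      (auto simp: space_cyl_measure)
  then show ?thesis by (simp add: sets_cyl_measure cong: measurable_cong_sets)
qed

lemma distr_rotate_cyl:
  assumes \<theta>: "0 \<le> \<theta>" "\<theta> \<le> 2 * pi * R"
  shows "distr (cyl_measure R) (cyl_measure R) (rotate_cyl R \<theta>) = cyl_measure R"
proof (rule measure_eqI)
  note [measurable] = rotate_cyl_measurable[OF \<theta>]
  fix A assume "A \<in> sets (distr (cyl_measure R) (cyl_measure R) (rotate_cyl R \<theta>))"
  then have A [measurable]: "A \<in> sets (cyl_measure R)" by simp
  then have [measurable]: "A \<in> sets borel"
    by (auto simp: sets_cyl_measure sets_restrict_space_iff)
  have "emeasure (distr (cyl_measure R) (cyl_measure R) (rotate_cyl R \<theta>)) A
      = (\<integral>\<^sup>+z. indicator A (rotate_cyl R \<theta> z) \<partial>cyl_measure R)"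
    using nn_integral_distr[OF rotate_cyl_measurable[OF \<theta>], of "indicator A"] A by simp
  also have "\<dots> = emeasure (cyl_measure R) A"
    using A by (simp add: nn_integral_rotate_cyl[OF _ \<theta>])
  finally show "emeasure (distr (cyl_measure R) (cyl_measure R) (rotate_cyl R \<theta>)) A
    = emeasure (cyl_measure R) A" .
qed simp

lemma distr_PiM_componentwise:
  assumes "product_sigma_finite M" "product_sigma_finite N" and fin: "finite U"
    and f: "\<And>i. i \<in> U \<Longrightarrow> f i \<in> M i \<rightarrow>\<^sub>M N i" "\<And>i. i \<in> U \<Longrightarrow> distr (M i) (N i) (f i) = N i"
  shows "distr (PiM U M) (PiM U N) (\<lambda>x. \<lambda>i\<in>U. f i (x i)) = PiM U N"
proof -
  interpret M: product_sigma_finite M by fact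
  interpret N: product_sigma_finite N by fact
  have meas: "(\<lambda>x. \<lambda>i\<in>U. f i (x i)) \<in> PiM U M \<rightarrow>\<^sub>M PiM U N"
    using f(1) by (intro measurable_restrict measurable_compose[OF measurable_component_singleton])
  show ?thesis
  proof (rule N.PiM_eqI[OF fin])
    fix A assume A: "\<And>i. i \<in> U \<Longrightarrow> A i \<in> sets (N i)"
    define B where "B i = f i -` A i \<inter> space (M i)" for i
    have B: "B i \<in> sets (M i)" "emeasure (M i) (B i) = emeasure (N i) (A i)" if "i \<in> U" for i
      using measurable_sets[OF f(1) A, OF that that] emeasure_distr[OF f(1) A, OF that that]
      by (simp_all add: B_def f(2)[OF that])
    have "(\<lambda>x. \<lambda>i\<in>U. f i (x i)) -` Pi\<^sub>E U A \<inter> space (PiM U M) = Pi\<^sub>E U B"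
      by (auto simp: B_def space_PiM PiE_iff)
    moreover have "Pi\<^sub>E U A \<in> sets (PiM U N)" using A fin by (intro sets_PiM_I_finite) auto
    ultimately show "emeasure (distr (PiM U M) (PiM U N) (\<lambda>x. \<lambda>i\<in>U. f i (x i))) (Pi\<^sub>E U A)
        = (\<Prod>i\<in>U. emeasure (N i) (A i))"
      using B fin by (simp add: emeasure_distr[OF meas] M.emeasure_PiM)
  qed simp
qed

definition rotate_config :: "real \<Rightarrow> 'i set \<Rightarrow> ('i \<Rightarrow> real) \<Rightarrow> ('i \<Rightarrow> complex) \<Rightarrow> 'i \<Rightarrow> complex" where
  "rotate_config R A \<theta> z = (\<lambda>i. if i \<in> A then rotate_cyl R (\<theta> i) (z i) else z i)"

lemma
  assumes U: "finite U" "A \<subseteq> U" and \<theta>: "\<And>i. i \<in> A \<Longrightarrow> 0 \<le> \<theta> i \<and> \<theta> i \<le> 2 * pi * R"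
  shows rotate_config_measurable:
      "rotate_config R A \<theta> \<in> PiM U (\<lambda>_. cyl_measure R) \<rightarrow>\<^sub>M PiM U (\<lambda>_. cyl_measure R)" (is ?meas)
    and distr_rotate_config:
      "distr (PiM U (\<lambda>_. cyl_measure R)) (PiM U (\<lambda>_. cyl_measure R)) (rotate_config R A \<theta>)
        = PiM U (\<lambda>_. cyl_measure R)" (is ?distr)
proof -
  let ?\<mu> = "PiM U (\<lambda>_. cyl_measure R)"
  define f where "f i = (if i \<in> A then rotate_cyl R (\<theta> i) else id)" for i
  have restrict: "rotate_config R A \<theta> z = (\<lambda>i\<in>U. f i (z i))" if "z \<in> space ?\<mu>" for z
    using that U(2)
    by (auto simp: rotate_config_def f_def space_PiM PiE_iff extensional_def fun_eq_iff)
  have f: "f i \<in> cyl_measure R \<rightarrow>\<^sub>M cyl_measure R"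
    "distr (cyl_measure R) (cyl_measure R) (f i) = cyl_measure R" for i
    using \<theta>
    by (simp_all add: f_def rotate_cyl_measurable distr_rotate_cyl
      distr_id2[unfolded id_def[symmetric]])
  have "(\<lambda>z. \<lambda>i\<in>U. f i (z i)) \<in> ?\<mu> \<rightarrow>\<^sub>M ?\<mu>"
    by (intro measurable_restrict measurable_compose[OF measurable_component_singleton] f)
  then show ?meas by (simp add: restrict cong: measurable_cong)
  show ?distr
    using distr_PiM_componentwise[OF product_sigma_finite_cyl product_sigma_finite_cyl U(1) f]
    by (simp add: restrict cong: distr_cong)
qed

section \<open>Averages over roots of unity\<close>

definition unity_root :: "nat \<Rightarrow> nat \<Rightarrow> complex" where
  "unity_root q s = cis (2 * pi * real s / real q)"

lemma norm_unity_root [simp]: "cmod (unity_root q s) = 1"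
  by (simp add: unity_root_def)

lemma unity_root_orthogonal:
  assumes "m < q" "n < q"
  shows "(\<Sum>s<q. unity_root q s ^ m * cnj (unity_root q s ^ n)) = (if m = n then of_nat q else 0)"
proof -
  define z where "z = unity_root q m / unity_root q n"
  have "unity_root q s ^ k = unity_root q k ^ s" for k s
    by (simp add: unity_root_def Complex.DeMoivre mult_ac)
  then have summand: "unity_root q s ^ m * cnj (unity_root q s ^ n) = z ^ s" for s
    by (simp add: z_def power_mult_distrib unity_root_def cis_cnj divide_complex_def)
  have "bij_betw (unity_root q) {..<q} {z. z ^ q = 1}"
    unfolding unity_root_def using assms by (intro Complex.bij_betw_roots_unity) simp
  then have inj: "inj_on (unity_root q) {..<q}" and power: "\<And>k. k < q \<Longrightarrow> unity_root q k ^ q = 1"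
    by (auto simp: bij_betw_def)
  show ?thesis
  proof (cases "m = n")
    case True
    then have "z = 1" by (simp add: z_def unity_root_def)
    then show ?thesis using True unfolding summand by simp
  next
    case False
    then have "z \<noteq> 1"
      using inj assms by (auto simp: z_def inj_on_def divide_eq_1_iff)
    moreover have "z ^ q = 1"
      using power assms by (simp add: z_def power_divide)
    ultimately show ?thesis using False unfolding summand by (simp add: sum_gp_strict)
  qed
qed

lemma sum_cmod_square_orthogonal:
  fixes e :: "'s \<Rightarrow> 'm \<Rightarrow> complex"
  assumes M: "finite M"
    and orth: "\<And>m n. m \<in> M \<Longrightarrow> n \<in> M \<Longrightarrow> (\<Sum>s\<in>S. e s m * cnj (e s n)) = (if m = n then of_real C else 0)"
  shows "(\<Sum>s\<in>S. (cmod (\<Sum>m\<in>M. b m * e s m))\<^sup>2) = C * (\<Sum>m\<in>M. (cmod (b m))\<^sup>2)"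
proof -
  have "complex_of_real (\<Sum>s\<in>S. (cmod (\<Sum>m\<in>M. b m * e s m))\<^sup>2)
      = (\<Sum>s\<in>S. \<Sum>m\<in>M. \<Sum>n\<in>M. b m * cnj (b n) * (e s m * cnj (e s n)))"
    by (simp add: complex_norm_square sum_product mult_ac del: of_real_power)
  also have "\<dots> = (\<Sum>m\<in>M. \<Sum>s\<in>S. \<Sum>n\<in>M. b m * cnj (b n) * (e s m * cnj (e s n)))"
    by (rule sum.swap)
  also have "\<dots> = (\<Sum>m\<in>M. \<Sum>n\<in>M. b m * cnj (b n) * (\<Sum>s\<in>S. e s m * cnj (e s n)))"
    unfolding sum_distrib_left by (intro sum.cong refl sum.swap)
  also have "\<dots> = (\<Sum>m\<in>M. \<Sum>n\<in>M. if m = n then of_real C * (b m * cnj (b n)) else 0)"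
    by (intro sum.cong refl) (simp add: orth)
  also have "\<dots> = complex_of_real (C * (\<Sum>m\<in>M. (cmod (b m))\<^sup>2))"
    using M by (simp add: sum_distrib_left complex_norm_square del: of_real_power)
  finally show ?thesis by (simp only: of_real_eq_iff)
qed

lemma mean_square_ge_value_at_0:
  fixes P :: "complex poly"
  assumes "degree P < q"
  shows "real q * (cmod (poly P 0))\<^sup>2 \<le> (\<Sum>s<q. (cmod (poly P (unity_root q s)))\<^sup>2)"
proof -
  have "(\<Sum>s<q. (cmod (poly P (unity_root q s)))\<^sup>2) = real q * (\<Sum>n\<le>degree P. (cmod (coeff P n))\<^sup>2)"
    unfolding poly_altdef using assms
    by (intro sum_cmod_square_orthogonal) (auto simp: unity_root_orthogonal
      simp del: complex_cnj_power)
  moreover have "(cmod (coeff P 0))\<^sup>2 \<le> (\<Sum>n\<le>degree P. (cmod (coeff P n))\<^sup>2)"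
    by (intro member_le_sum) auto
  ultimately show ?thesis by (simp add: poly_0_coeff_0 mult_left_mono)
qed

definition monomial :: "'i set \<Rightarrow> ('i \<Rightarrow> nat) \<Rightarrow> ('i \<Rightarrow> 'c) \<Rightarrow> 'c::comm_monoid_mult" where
  "monomial U m x = (\<Prod>i\<in>U. x i ^ m i)"

definition scale_on :: "'i set \<Rightarrow> ('i \<Rightarrow> 'c) \<Rightarrow> ('i \<Rightarrow> 'c) \<Rightarrow> 'i \<Rightarrow> 'c::times" where
  "scale_on A w x = (\<lambda>i. if i \<in> A then w i * x i else x i)"

lemma monomial_scale_on:
  fixes x :: "'i \<Rightarrow> 'c::comm_monoid_mult"
  shows "monomial U m (scale_on U w x) = monomial U m x * monomial U m w"
  by (simp add: monomial_def scale_on_def power_mult_distrib prod.distrib mult.commute)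

lemma monomial_unity_root_orthogonal:
  assumes U: "finite U" and "\<And>i. i \<in> U \<Longrightarrow> m i < q" "\<And>i. i \<in> U \<Longrightarrow> n i < q"
  shows "(\<Sum>s\<in>Pi\<^sub>E U (\<lambda>_. {..<q}).
      monomial U m (\<lambda>i. unity_root q (s i)) * cnj (monomial U n (\<lambda>i. unity_root q (s i))))
    = (if \<forall>i\<in>U. m i = n i then of_nat (q ^ card U) else 0)" (is "?lhs = _")
proof -
  have "?lhs = (\<Sum>s\<in>Pi\<^sub>E U (\<lambda>_. {..<q}). \<Prod>i\<in>U. unity_root q (s i) ^ m i
      * cnj (unity_root q (s i) ^ n i))"
    by (simp add: monomial_def prod.distrib)
  also have "\<dots> = (\<Prod>i\<in>U. \<Sum>s<q. unity_root q s ^ m i * cnj (unity_root q s ^ n i))"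
    using U by (subst prod_sum_PiE) auto
  also have "\<dots> = (\<Prod>i\<in>U. if m i = n i then of_nat q else 0)"
    using assms by (intro prod.cong refl unity_root_orthogonal) auto
  also have "\<dots> = (if \<forall>i\<in>U. m i = n i then of_nat (q ^ card U) else 0)"
    using U by (auto simp: prod_zero)
  finally show ?thesis .
qed

lemma mean_square_over_torus:
  fixes x :: "'i \<Rightarrow> complex"
  assumes U: "finite U" and M: "finite M" and degree: "\<And>m i. m \<in> M \<Longrightarrow> i \<in> U \<Longrightarrow> m i < q"
    and supp: "\<And>m i. m \<in> M \<Longrightarrow> i \<notin> U \<Longrightarrow> m i = 0"
  shows "(\<Sum>s\<in>Pi\<^sub>E U (\<lambda>_. {..<q}).
      (cmod (\<Sum>m\<in>M. a m * monomial U m (scale_on U (\<lambda>i. unity_root q (s i)) x)))\<^sup>2)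
    = real (q ^ card U) * (\<Sum>m\<in>M. (cmod (a m * monomial U m x))\<^sup>2)"
  unfolding monomial_scale_on mult.assoc[symmetric]
proof (rule sum_cmod_square_orthogonal[OF M])
  fix m n assume mn: "m \<in> M" "n \<in> M"
  then have "(\<forall>i\<in>U. m i = n i) \<longleftrightarrow> m = n" using supp by (metis ext)
  then show "(\<Sum>s\<in>Pi\<^sub>E U (\<lambda>_. {..<q}). monomial U m (\<lambda>i. unity_root q (s i)) *
      cnj (monomial U n (\<lambda>i. unity_root q (s i))))
          = (if m = n then of_real (real (q ^ card U)) else 0)"
    using monomial_unity_root_orthogonal[OF U, of m q n] degree mn by simp
qed

section \<open>Square norms of polynomials in the exponential coordinates\<close>

abbreviation cyl_config :: "real \<Rightarrow> 'i set \<Rightarrow> ('i \<Rightarrow> complex) measure" where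
  "cyl_config R U \<equiv> PiM U (\<lambda>_. cyl_measure R)"

definition exp_coord :: "real \<Rightarrow> ('i \<Rightarrow> complex) \<Rightarrow> 'i \<Rightarrow> complex" where
  "exp_coord R z i = exp (z i / of_real R)"

lemma norm_exp_coord: "cmod (exp_coord R z i) = exp (Re (z i) / R)"
  by (simp add: exp_coord_def)

lemma exp_coord_measurable [measurable (raw)]:
  "i \<in> U \<Longrightarrow> (\<lambda>z. exp_coord R z i) \<in> borel_measurable (cyl_config R U)"
  unfolding exp_coord_def by measurable

lemma monomial_measurable [measurable]:
  "(\<lambda>z. monomial U m (exp_coord R z)) \<in> borel_measurable (cyl_config R U)"
  unfolding monomial_def by measurable

definition cyl_norm_square ::
    "real \<Rightarrow> 'i set \<Rightarrow> (('i \<Rightarrow> real) \<Rightarrow> ennreal) \<Rightarrow> (('i \<Rightarrow> complex) \<Rightarrow> complex) \<Rightarrow> ennreal" where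
  "cyl_norm_square R U h f
    = (\<integral>\<^sup>+z. ennreal ((cmod (f (exp_coord R z)))\<^sup>2) * h (Re \<circ> z) \<partial>cyl_config R U)"

lemma cyl_norm_square_cmult:
  assumes "(\<lambda>z. f (exp_coord R z)) \<in> borel_measurable (cyl_config R U)"
    and "(\<lambda>z. h (Re \<circ> z)) \<in> borel_measurable (cyl_config R U)"
  shows "cyl_norm_square R U (\<lambda>x. c * h x) f = c * cyl_norm_square R U h f"
  using assms unfolding cyl_norm_square_def
  by (simp add: mult.left_commute[of _ c] nn_integral_cmult)

context
  fixes U A :: "'i set" and R :: real and q :: nat
    and f :: "('i \<Rightarrow> complex) \<Rightarrow> complex" and h :: "('i \<Rightarrow> real) \<Rightarrow> ennreal"
  assumes U: "finite U" "A \<subseteq> U" and R: "R > 0"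
    and f: "(\<lambda>z. f (exp_coord R z)) \<in> borel_measurable (cyl_config R U)"
    and h: "(\<lambda>z. h (Re \<circ> z)) \<in> borel_measurable (cyl_config R U)"
begin

lemma
  assumes r: "\<And>i. i \<in> A \<Longrightarrow> r i < q"
  shows scale_on_exp_coord_measurable:
      "(\<lambda>z. f (scale_on A (\<lambda>i. unity_root q (r i)) (exp_coord R z)))
          \<in> borel_measurable (cyl_config R U)"
    and cyl_norm_square_scale_on:
      "cyl_norm_square R U h (\<lambda>x. f (scale_on A (\<lambda>i. unity_root q (r i)) x))
          = cyl_norm_square R U h f"
proof -
  define \<theta> where "\<theta> i = R * (2 * pi * real (r i) / real q)" for i
  let ?rot = "rotate_config R A \<theta>"
  have \<theta>: "0 \<le> \<theta> i \<and> \<theta> i \<le> 2 * pi * R" if "i \<in> A" for i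
  proof -
    have "real (r i) / real q \<le> 1" using r[OF that] by simp
    then have "2 * pi * R * (real (r i) / real q) \<le> 2 * pi * R"
      using R by (intro mult_left_le) auto
    then show ?thesis using R by (simp add: \<theta>_def mult_ac)
  qed
  note rot = rotate_config_measurable[where \<theta>=\<theta>, OF U \<theta>] distr_rotate_config[where \<theta>=\<theta>, OF U \<theta>]
  have exp_rot: "exp_coord R (?rot z) = scale_on A (\<lambda>i. unity_root q (r i)) (exp_coord R z)" for z
    using R by (auto simp: rotate_config_def exp_coord_def scale_on_def exp_rotate_cyl \<theta>_def
      unity_root_def)
  show "(\<lambda>z. f (scale_on A (\<lambda>i. unity_root q (r i)) (exp_coord R z)))
      \<in> borel_measurable (cyl_config R U)"
    using measurable_compose[OF rot(1) f] by (simp add: exp_rot)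
  define F where "F z = ennreal ((cmod (f (exp_coord R z)))\<^sup>2) * h (Re \<circ> z)" for z
  have F: "F \<in> borel_measurable (cyl_config R U)"
    using f h unfolding F_def by measurable
  have "Re \<circ> ?rot z = Re \<circ> z" for z
    by (auto simp: rotate_config_def)
  then have "cyl_norm_square R U h (\<lambda>x. f (scale_on A (\<lambda>i. unity_root q (r i)) x))
      = (\<integral>\<^sup>+z. F (?rot z) \<partial>cyl_config R U)"
    by (simp add: cyl_norm_square_def F_def exp_rot)
  also have "\<dots> = (\<integral>\<^sup>+z. F z \<partial>cyl_config R U)"
    using nn_integral_distr[OF rot(1), of F] F by (simp add: rot(2))
  finally show "cyl_norm_square R U h (\<lambda>x. f (scale_on A (\<lambda>i. unity_root q (r i)) x))
      = cyl_norm_square R U h f"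
    by (simp add: cyl_norm_square_def F_def)
qed

lemma nn_integral_mean_over_rotations:
  fixes r :: "'s \<Rightarrow> 'i \<Rightarrow> nat"
  assumes S: "finite S" "S \<noteq> {}" and r: "\<And>s i. s \<in> S \<Longrightarrow> i \<in> A \<Longrightarrow> r s i < q"
  shows "(\<integral>\<^sup>+z. ennreal ((\<Sum>s\<in>S. (cmod (f (scale_on A (\<lambda>i. unity_root q (r s i)) (exp_coord R z))))\<^sup>2)
      / real (card S)) * h (Re \<circ> z) \<partial>cyl_config R U) = cyl_norm_square R U h f"
proof -
  let ?f = "\<lambda>s z. f (scale_on A (\<lambda>i. unity_root q (r s i)) (exp_coord R z))"
  note [measurable] = h scale_on_exp_coord_measurable
  have "ennreal ((\<Sum>s\<in>S. (cmod (?f s z))\<^sup>2) / real (card S)) * h (Re \<circ> z)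
      = (\<Sum>s\<in>S. ennreal ((cmod (?f s z))\<^sup>2) * h (Re \<circ> z)) / of_nat (card S)" for z
  proof -
    have "ennreal ((\<Sum>s\<in>S. (cmod (?f s z))\<^sup>2) / real (card S))
        = (\<Sum>s\<in>S. ennreal ((cmod (?f s z))\<^sup>2)) / of_nat (card S)"
      using S by (simp add: divide_ennreal sum_nonneg card_gt_0_iff ennreal_of_nat_eq_real_of_nat)
    then show ?thesis
      by (simp add: divide_ennreal_def mult_ac del: sum_ennreal)
        (simp only: sum_distrib_left mult_ac)
  qed
  then have "(\<integral>\<^sup>+z. ennreal ((\<Sum>s\<in>S. (cmod (?f s z))\<^sup>2) / real (card S))
      * h (Re \<circ> z) \<partial>cyl_config R U)
      = (\<Sum>s\<in>S. cyl_norm_square R U h (\<lambda>x. f (scale_on A (\<lambda>i. unity_root q (r s i)) x)))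
          / of_nat (card S)"
    using r by (simp add: nn_integral_divide nn_integral_sum cyl_norm_square_def)
  also have "\<dots> = cyl_norm_square R U h f * of_nat (card S) / of_nat (card S)"
    using r by (simp add: cyl_norm_square_scale_on mult.commute)
  finally show ?thesis
    using S by (simp add: ennreal_mult_divide_eq)
qed

end

lemma cyl_norm_square_sum_monomials:
  fixes h :: "('i \<Rightarrow> real) \<Rightarrow> ennreal"
  assumes U: "finite U" and M: "finite M" and R: "R > 0"
    and supp: "\<And>m i. m \<in> M \<Longrightarrow> i \<notin> U \<Longrightarrow> m i = 0"
    and h: "(\<lambda>z. h (Re \<circ> z)) \<in> borel_measurable (cyl_config R U)"
  shows "cyl_norm_square R U h (\<lambda>x. \<Sum>m\<in>M. a m * monomial U m x)
    = (\<Sum>m\<in>M. ennreal ((cmod (a m))\<^sup>2) * cyl_norm_square R U h (monomial U m))"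
proof -
  define f where "f x = (\<Sum>m\<in>M. a m * monomial U m x)" for x
  note [measurable] = h
  have f: "(\<lambda>z. f (exp_coord R z)) \<in> borel_measurable (cyl_config R U)"
    unfolding f_def by measurable
  define q where "q = Suc (\<Sum>m\<in>M. \<Sum>i\<in>U. m i)"
  have "q > 0" by (simp add: q_def)
  have degree: "m i < q" if "m \<in> M" "i \<in> U" for m i
  proof -
    have "m i \<le> (\<Sum>i\<in>U. m i)" using that U by (intro member_le_sum) auto
    also have "\<dots> \<le> (\<Sum>m\<in>M. \<Sum>i\<in>U. m i)" using that M by (intro member_le_sum) auto
    finally show "m i < q" by (simp add: q_def)
  qed
  let ?S = "Pi\<^sub>E U (\<lambda>_. {..<q})"
  have S: "finite ?S" "?S \<noteq> {}" "card ?S = q ^ card U"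
    using U by (auto simp: card_PiE finite_PiE PiE_eq_empty_iff q_def)
  have mean: "(\<Sum>s\<in>?S. (cmod (f (scale_on U (\<lambda>i. unity_root q (s i)) x)))\<^sup>2) / real (card ?S)
      = (\<Sum>m\<in>M. (cmod (a m))\<^sup>2 * (cmod (monomial U m x))\<^sup>2)" for x
    using mean_square_over_torus[of U M q a x, OF U M] degree supp S(3)
    by (simp add: f_def norm_mult power_mult_distrib divide_eq_eq \<open>q > 0\<close>)
  have "cyl_norm_square R U h f
      = (\<integral>\<^sup>+z. ennreal (\<Sum>m\<in>M. (cmod (a m))\<^sup>2 * (cmod (monomial U m (exp_coord R z)))\<^sup>2)
          * h (Re \<circ> z) \<partial>cyl_config R U)"
    unfolding mean[symmetric]
    by (rule nn_integral_mean_over_rotations[symmetric, OF U order.refl R f h S(1,2)]) auto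
  also have "\<dots> = (\<integral>\<^sup>+z. (\<Sum>m\<in>M. ennreal ((cmod (a m))\<^sup>2)
      * (ennreal ((cmod (monomial U m (exp_coord R z)))\<^sup>2) * h (Re \<circ> z))) \<partial>cyl_config R U)"
    by (simp add: ennreal_mult sum_distrib_left mult_ac flip: sum_ennreal)
  also have "\<dots> = (\<Sum>m\<in>M. ennreal ((cmod (a m))\<^sup>2) * cyl_norm_square R U h (monomial U m))"
    by (simp add: cyl_norm_square_def nn_integral_sum nn_integral_cmult)
  finally show ?thesis unfolding f_def .
qed

definition monomial_span :: "'i set \<Rightarrow> ('i \<Rightarrow> nat) set \<Rightarrow> (('i \<Rightarrow> complex) \<Rightarrow> complex) set" where
  "monomial_span U \<Lambda> = {f. \<exists>M a. finite M \<and> M \<subseteq> \<Lambda> \<and> f = (\<lambda>x. \<Sum>m\<in>M. a m * monomial U m x)}"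

lemma monomial_span_measurable:
  assumes "f \<in> monomial_span U \<Lambda>"
  shows "(\<lambda>z. f (exp_coord R z)) \<in> borel_measurable (cyl_config R U)"
  using assms by (auto simp: monomial_span_def)

context
  fixes U :: "'i set" and R :: real and \<Lambda> :: "('i \<Rightarrow> nat) set" and f :: "('i \<Rightarrow> complex) \<Rightarrow> complex"
  assumes U: "finite U" and R: "R > 0" and f: "f \<in> monomial_span U \<Lambda>"
    and supp: "\<forall>m\<in>\<Lambda>. \<forall>i. i \<notin> U \<longrightarrow> m i = 0"
begin

lemma monomial_span_norm_squareE:
  obtains M a where "finite M" "M \<subseteq> \<Lambda>" "f = (\<lambda>x. \<Sum>m\<in>M. a m * monomial U m x)"
    "\<And>h. (\<lambda>z. h (Re \<circ> z)) \<in> borel_measurable (cyl_config R U) \<Longrightarrow>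
      cyl_norm_square R U h f
          = (\<Sum>m\<in>M. ennreal ((cmod (a m))\<^sup>2) * cyl_norm_square R U h (monomial U m))"
proof -
  obtain M a where M: "finite M" "M \<subseteq> \<Lambda>" "f = (\<lambda>x. \<Sum>m\<in>M. a m * monomial U m x)"
    using f by (auto simp: monomial_span_def)
  show thesis
    by (rule that[OF M], unfold M(3), rule cyl_norm_square_sum_monomials[OF U M(1) R])
      (use M(2) supp in auto)
qed

lemma cyl_norm_square_monomial_span_mono:
  assumes "(\<lambda>z. g (Re \<circ> z)) \<in> borel_measurable (cyl_config R U)"
    and "(\<lambda>z. h (Re \<circ> z)) \<in> borel_measurable (cyl_config R U)"
    and "\<And>m. m \<in> \<Lambda> \<Longrightarrow> cyl_norm_square R U g (monomial U m) \<le> cyl_norm_square R U h (monomial U m)"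
  shows "cyl_norm_square R U g f \<le> cyl_norm_square R U h f"
proof (rule monomial_span_norm_squareE)
  fix M a assume "M \<subseteq> \<Lambda>" and norm: "\<And>h. (\<lambda>z. h (Re \<circ> z)) \<in> borel_measurable (cyl_config R U) \<Longrightarrow>
      cyl_norm_square R U h f
          = (\<Sum>m\<in>M. ennreal ((cmod (a m))\<^sup>2) * cyl_norm_square R U h (monomial U m))"
  then show ?thesis
    unfolding norm[OF assms(1)] norm[OF assms(2)]
    by (intro sum_mono mult_left_mono assms(3)) auto
qed

lemma cyl_norm_square_monomial_span_finite:
  assumes "(\<lambda>z. h (Re \<circ> z)) \<in> borel_measurable (cyl_config R U)"
    and "\<And>m. m \<in> \<Lambda> \<Longrightarrow> cyl_norm_square R U h (monomial U m) < \<infinity>"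
  shows "cyl_norm_square R U h f < \<infinity>"
proof (rule monomial_span_norm_squareE)
  fix M a assume "finite M" "M \<subseteq> \<Lambda>"
    and norm: "\<And>h. (\<lambda>z. h (Re \<circ> z)) \<in> borel_measurable (cyl_config R U) \<Longrightarrow>
      cyl_norm_square R U h f
          = (\<Sum>m\<in>M. ennreal ((cmod (a m))\<^sup>2) * cyl_norm_square R U h (monomial U m))"
  then show ?thesis
    unfolding norm[OF assms(1)] using assms(2) by (auto simp: ennreal_mult_less_top)
qed

lemma cyl_norm_square_monomial_span_pos:
  assumes h: "(\<lambda>z. h (Re \<circ> z)) \<in> borel_measurable (cyl_config R U)" and "f x \<noteq> 0"
    and pos: "\<And>m. m \<in> \<Lambda> \<Longrightarrow> 0 < cyl_norm_square R U h (monomial U m)"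
  shows "0 < cyl_norm_square R U h f"
proof (rule monomial_span_norm_squareE)
  fix M a assume M: "finite M" "M \<subseteq> \<Lambda>" "f = (\<lambda>x. \<Sum>m\<in>M. a m * monomial U m x)"
    and norm: "\<And>h. (\<lambda>z. h (Re \<circ> z)) \<in> borel_measurable (cyl_config R U) \<Longrightarrow>
      cyl_norm_square R U h f
          = (\<Sum>m\<in>M. ennreal ((cmod (a m))\<^sup>2) * cyl_norm_square R U h (monomial U m))"
  obtain m where m: "m \<in> M" "a m \<noteq> 0"
    using \<open>f x \<noteq> 0\<close> unfolding M(3) by (auto elim: sum.not_neutral_contains_not_neutral)
  have "0 < ennreal ((cmod (a m))\<^sup>2) * cyl_norm_square R U h (monomial U m)"
    using m pos[of m] M(2) by (auto simp: ennreal_zero_less_mult_iff)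
  also have "\<dots> \<le> cyl_norm_square R U h f"
    unfolding norm[OF h] using m(1) M(1) by (intro member_le_sum) auto
  finally show ?thesis .
qed

end

section \<open>Exponents of edge products\<close>

lemma monomial_spanI:
  assumes "finite T" "\<phi> ` T \<subseteq> \<Lambda>"
  shows "(\<lambda>x. \<Sum>t\<in>T. a t * monomial U (\<phi> t) x) \<in> monomial_span U \<Lambda>"
proof -
  have "(\<Sum>t\<in>T. a t * monomial U (\<phi> t) x)
      = (\<Sum>m\<in>\<phi> ` T. (\<Sum>t\<in>{t \<in> T. \<phi> t = m}. a t) * monomial U m x)" for x
    using sum.image_gen[OF assms(1), of "\<lambda>t. a t * monomial U (\<phi> t) x" \<phi>]
    by (simp add: sum_distrib_right)
  then show ?thesis
    using assms unfolding monomial_span_def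
    by (intro CollectI exI[of _ "\<phi> ` T"] exI[of _ "\<lambda>m. \<Sum>t\<in>{t \<in> T. \<phi> t = m}. a t"]) auto
qed

lemma monomial_in_span: "m \<in> \<Lambda> \<Longrightarrow> monomial U m \<in> monomial_span U \<Lambda>"
  using monomial_spanI[of "{m}" "\<lambda>m. m" \<Lambda> "\<lambda>_. 1" U] by simp

lemma monomial_add:
  fixes x :: "'i \<Rightarrow> 'c::comm_monoid_mult"
  shows "monomial U (\<lambda>i. m i + n i) x = monomial U m x * monomial U n x"
  by (simp add: monomial_def power_add prod.distrib)

lemma monomial_span_mult:
  assumes "f \<in> monomial_span U \<Lambda>" "g \<in> monomial_span U \<Lambda>'"
    and add: "\<And>m n. m \<in> \<Lambda> \<Longrightarrow> n \<in> \<Lambda>' \<Longrightarrow> (\<lambda>i. m i + n i) \<in> \<Lambda>''"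
  shows "(\<lambda>x. f x * g x) \<in> monomial_span U \<Lambda>''"
proof -
  obtain M a where M: "finite M" "M \<subseteq> \<Lambda>" "f = (\<lambda>x. \<Sum>m\<in>M. a m * monomial U m x)"
    using assms(1) by (auto simp: monomial_span_def)
  obtain N b where N: "finite N" "N \<subseteq> \<Lambda>'" "g = (\<lambda>x. \<Sum>n\<in>N. b n * monomial U n x)"
    using assms(2) by (auto simp: monomial_span_def)
  let ?add = "\<lambda>mn i. fst mn i + snd mn i"
  have "(\<lambda>x. f x * g x) = (\<lambda>x. \<Sum>mn\<in>M \<times> N. a (fst mn) * b (snd mn) * monomial U (?add mn) x)"
    by (simp add: M(3) N(3) sum_product sum.cartesian_product split_def monomial_add mult_ac)
  moreover have "?add ` (M \<times> N) \<subseteq> \<Lambda>''"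
    using M(2) N(2) by (auto intro!: add)
  then have "(\<lambda>x. \<Sum>mn\<in>M \<times> N. a (fst mn) * b (snd mn) * monomial U (?add mn) x)
      \<in> monomial_span U \<Lambda>''"
    by (rule monomial_spanI[OF finite_cartesian_product[OF M(1) N(1)]])
  ultimately show ?thesis by simp
qed

definition edge_exponent :: "nat \<Rightarrow> 'i \<Rightarrow> 'i \<Rightarrow> nat \<Rightarrow> 'i \<Rightarrow> nat" where
  "edge_exponent p i j r v = (if v = i then r else 0) + (if v = j then p - r else 0)"

lemma monomial_edge_exponent:
  fixes x :: "'i \<Rightarrow> 'c::comm_monoid_mult"
  assumes "finite U" "i \<in> U" "j \<in> U"
  shows "monomial U (edge_exponent p i j r) x = x i ^ r * x j ^ (p - r)"
  using assms
  by (simp add: monomial_def edge_exponent_def power_add prod.distrib if_distrib[of "(^) _"]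
    cong: if_cong)

lemma sum_edge_exponent:
  "finite S \<Longrightarrow> sum (edge_exponent p i j r) S
      = (if i \<in> S then r else 0) + (if j \<in> S then p - r else 0)"
  by (simp add: edge_exponent_def sum.distrib)

lemma difference_power_in_span:
  assumes "finite U" "i \<in> U" "j \<in> U"
  shows "(\<lambda>x. (x j - x i) ^ p) \<in> monomial_span U (edge_exponent p i j ` {..p})"
proof -
  have "(x j - x i) ^ p
      = (\<Sum>r\<le>p. of_nat (p choose r) * (-1) ^ r * monomial U (edge_exponent p i j r) x)"
    for x :: "'a \<Rightarrow> complex"
  proof -
    have "(x j - x i) ^ p = (- x i + x j) ^ p" by simp
    also have "\<dots> = (\<Sum>r\<le>p. of_nat (p choose r) * (-1) ^ r * (x i ^ r * x j ^ (p - r)))"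
      unfolding binomial_ring by (intro sum.cong refl) (subst power_minus, simp)
    finally show ?thesis using assms by (simp add: monomial_edge_exponent)
  qed
  then show ?thesis by (simp add: monomial_spanI)
qed

definition edge_prod :: "nat \<Rightarrow> ('i \<times> 'i) set \<Rightarrow> ('i \<Rightarrow> complex) \<Rightarrow> complex" where
  "edge_prod p E x = (\<Prod>(i, j)\<in>E. (x j - x i) ^ p)"

lemma cmod_edge_prod: "cmod (edge_prod p E x) = (\<Prod>(i, j)\<in>E. cmod (x j - x i) ^ p)"
  by (simp add: edge_prod_def split_def norm_power flip: prod_norm)

lemma edge_prod_measurable:
  assumes "E \<subseteq> U \<times> U"
  shows "(\<lambda>z. edge_prod p E (exp_coord R z)) \<in> borel_measurable (cyl_config R U)"
proof -
  have "fst e \<in> U" "snd e \<in> U" if "e \<in> E" for e using that assms by auto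
  then show ?thesis unfolding edge_prod_def split_def by measurable
qed

text \<open>Expanding an edge product picks one endpoint of each edge, \<open>p\<close> times: an edge inside \<open>S\<close>
  contributes \<open>p\<close> to the exponents in \<open>S\<close>, and an edge meeting \<open>S\<close> contributes at most \<open>p\<close>.\<close>

definition edge_exponents :: "'i set \<Rightarrow> nat \<Rightarrow> ('i \<times> 'i) set \<Rightarrow> ('i \<Rightarrow> nat) \<Rightarrow> ('i \<Rightarrow> nat) set" where
  "edge_exponents U p E c = {m. (\<forall>i. i \<notin> U \<longrightarrow> m i = 0) \<and>
    (\<forall>S\<subseteq>U. p * card (E \<inter> S \<times> S) + sum c S \<le> sum m S
      \<and> sum m S \<le> p * card (E - (- S) \<times> (- S)) + sum c S)}"

lemma edge_exponentsD:
  assumes "m \<in> edge_exponents U p E c"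
  shows "i \<notin> U \<Longrightarrow> m i = 0"
    and "S \<subseteq> U \<Longrightarrow> p * card (E \<inter> S \<times> S) + sum c S \<le> sum m S"
    and "S \<subseteq> U \<Longrightarrow> sum m S \<le> p * card (E - (- S) \<times> (- S)) + sum c S"
  using assms by (simp_all add: edge_exponents_def)

lemma edge_exponents_insert:
  assumes U: "finite U" "i \<in> U" "j \<in> U" and E: "finite E" "(i, j) \<notin> E" and r: "r \<le> p"
    and m: "m \<in> edge_exponents U p E c"
  shows "(\<lambda>v. edge_exponent p i j r v + m v) \<in> edge_exponents U p (insert (i, j) E) c"
  unfolding edge_exponents_def
proof (intro CollectI conjI allI impI)
  show "edge_exponent p i j r v + m v = 0" if "v \<notin> U" for v
    using that U edge_exponentsD(1)[OF m that] by (auto simp: edge_exponent_def)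
  fix S assume S: "S \<subseteq> U"
  then have "finite S" using U(1) finite_subset by blast
  then have sum: "(\<Sum>v\<in>S. edge_exponent p i j r v + m v)
      = (if i \<in> S then r else 0) + (if j \<in> S then p - r else 0) + sum m S"
    by (simp add: sum.distrib sum_edge_exponent)
  have "card (insert (i, j) E \<inter> S \<times> S) = card (E \<inter> S \<times> S) + (if i \<in> S \<and> j \<in> S then 1 else 0)"
    using E by (simp add: Int_insert_left)
  then show "p * card (insert (i, j) E \<inter> S \<times> S) + sum c S \<le> (\<Sum>v\<in>S. edge_exponent p i j r v + m v)"
    using edge_exponentsD(2)[OF m S] r unfolding sum by (auto simp: algebra_simps)
  have "card (insert (i, j) E - (- S) \<times> (- S))
      = card (E - (- S) \<times> (- S)) + (if i \<in> S \<or> j \<in> S then 1 else 0)"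
    using E by (simp add: insert_Diff_if)
  then show "(\<Sum>v\<in>S. edge_exponent p i j r v + m v)
      \<le> p * card (insert (i, j) E - (- S) \<times> (- S)) + sum c S"
    using edge_exponentsD(3)[OF m S] r unfolding sum by (auto simp: algebra_simps)
qed

lemma edge_prod_mult_monomial_in_span:
  assumes U: "finite U" and E: "E \<subseteq> U \<times> U" and c: "\<And>i. i \<notin> U \<Longrightarrow> c i = 0"
  shows "(\<lambda>x. edge_prod p E x * monomial U c x) \<in> monomial_span U (edge_exponents U p E c)"
proof -
  have "finite E" using U E finite_subset by blast
  then show ?thesis using E
  proof (induction E rule: finite_induct)
    case empty
    have "c \<in> edge_exponents U p {} c" using c by (simp add: edge_exponents_def)
    then show ?case by (simp add: edge_prod_def monomial_in_span)
  next
    case (insert e E)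
    obtain i j where e: "e = (i, j)" by (cases e)
    have ij: "i \<in> U" "j \<in> U" "(i, j) \<notin> E" using insert by (auto simp: e)
    have "(\<lambda>x. (x j - x i) ^ p) \<in> monomial_span U (edge_exponent p i j ` {..p})"
      using U ij by (intro difference_power_in_span)
    moreover have "(\<lambda>x. edge_prod p E x * monomial U c x)
        \<in> monomial_span U (edge_exponents U p E c)"
      using insert by simp
    ultimately have "(\<lambda>x. (x j - x i) ^ p * (edge_prod p E x * monomial U c x))
        \<in> monomial_span U (edge_exponents U p (insert e E) c)"
    proof (rule monomial_span_mult)
      fix n m assume "n \<in> edge_exponent p i j ` {..p}" "m \<in> edge_exponents U p E c"
      then show "(\<lambda>v. n v + m v) \<in> edge_exponents U p (insert e E) c"
        using edge_exponents_insert[OF U ij(1,2) insert.hyps(1) ij(3)] by (auto simp: e)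
    qed
    moreover have "edge_prod p (insert e E) x = (x j - x i) ^ p * edge_prod p E x" for x
      using insert.hyps by (simp add: edge_prod_def e)
    ultimately show ?case by (simp add: mult.assoc)
  qed
qed

definition ordered_pairs :: "'i::linorder set \<Rightarrow> ('i \<times> 'i) set" where
  "ordered_pairs I = {(i, j). i \<in> I \<and> j \<in> I \<and> i < j}"

lemma ordered_pairs_subset: "ordered_pairs I \<subseteq> I \<times> I"
  by (auto simp: ordered_pairs_def)

lemma finite_ordered_pairs [simp]: "finite I \<Longrightarrow> finite (ordered_pairs I)"
  by (rule finite_subset[OF ordered_pairs_subset]) simp

lemma card_ordered_pairs:
  assumes "finite I"
  shows "2 * real (card (ordered_pairs I)) = real (card I) * (real (card I) - 1)"
  using assms
proof (induction I rule: finite_linorder_max_induct)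
  case empty
  then show ?case by (simp add: ordered_pairs_def)
next
  case (insert b A)
  have "ordered_pairs (insert b A) = ordered_pairs A \<union> A \<times> {b}"
    using insert by (force simp: ordered_pairs_def)
  moreover have "card (ordered_pairs A \<union> A \<times> {b}) = card (ordered_pairs A) + card (A \<times> {b})"
    using insert by (intro card_Un_disjoint) (simp, simp, auto simp: ordered_pairs_def)
  ultimately have "card (ordered_pairs (insert b A)) = card (ordered_pairs A) + card A"
    by (simp add: card_cartesian_product)
  moreover have "b \<notin> A" using insert by auto
  ultimately show ?case using insert by (simp add: algebra_simps)
qed

text \<open>The largest label goes to the largest value, which is at least the average.\<close>

lemma labelling_of_quadratic_sums:
  fixes d :: "'i \<Rightarrow> real"
  assumes "finite I" and "\<And>S. S \<subseteq> I \<Longrightarrow> c * (real (card S))\<^sup>2 \<le> sum d S"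
  shows "\<exists>lab. bij_betw lab I {1..card I} \<and> (\<forall>i\<in>I. c * real (lab i) \<le> d i)"
  using assms
proof (induction "card I" arbitrary: I)
  case 0
  then show ?case by (auto simp: bij_betw_def)
next
  case (Suc n)
  have "\<exists>i\<in>I. c * real (card I) \<le> d i"
  proof (rule ccontr)
    assume "\<not> ?thesis"
    then have "sum d I < (\<Sum>i\<in>I. c * real (card I))"
      using Suc.hyps(2) Suc.prems(1) by (intro sum_strict_mono) (auto simp: not_le)
    then show False using Suc.prems(2)[of I] by (simp add: power2_eq_square mult_ac)
  qed
  then obtain i where i: "i \<in> I" "c * real (card I) \<le> d i" ..
  have n: "n = card (I - {i})" using Suc i by simp
  have "\<exists>lab. bij_betw lab (I - {i}) {1..card (I - {i})} \<and> (\<forall>j\<in>I - {i}. c * real (lab j) \<le> d j)"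
    by (rule Suc.hyps(1)[OF n]) (use Suc.prems in auto)
  then obtain lab where lab: "bij_betw lab (I - {i}) {1..n}" "\<forall>j\<in>I - {i}. c * real (lab j) \<le> d j"
    unfolding n by blast
  let ?lab = "lab(i := Suc n)"
  have "bij_betw ?lab (I - {i}) {1..n}" using lab(1) by (subst bij_betw_cong[of _ ?lab lab]) auto
  then have "bij_betw ?lab (insert i (I - {i})) (insert (Suc n) {1..n})"
    using bij_betw_combine[of ?lab "{i}" "{Suc n}" "I - {i}" "{1..n}"] by (auto simp: bij_betw_def)
  moreover have "insert i (I - {i}) = I" "insert (Suc n) {1..n} = {1..card I}"
    using i Suc.hyps(2) by auto
  ultimately show ?case using lab(2) i Suc.hyps(2) by (intro exI[of _ ?lab]) auto
qed

section \<open>Splitting the particles into two groups\<close>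

locale bipartition =
  fixes p :: nat and I J :: "'i::linorder set"
  assumes finite_parts: "finite I" "finite J" and disjoint: "I \<inter> J = {}"
begin

definition split_edges :: "('i \<times> 'i) set" where
  "split_edges = ordered_pairs I \<union> ordered_pairs J"

definition right_exponent :: "'i \<Rightarrow> nat" where
  "right_exponent i = (if i \<in> J then p * card I else 0)"

definition split_poly :: "('i \<Rightarrow> complex) \<Rightarrow> complex" where
  "split_poly x = edge_prod p split_edges x * monomial (I \<union> J) right_exponent x"

abbreviation full_poly :: "('i \<Rightarrow> complex) \<Rightarrow> complex" where
  "full_poly \<equiv> edge_prod p (ordered_pairs (I \<union> J))"

definition split_exponents :: "('i \<Rightarrow> nat) set" where
  "split_exponents = edge_exponents (I \<union> J) p split_edges right_exponent"

definition side :: "'i \<Rightarrow> real" where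
  "side i = (if i \<in> I then 1 else - 1)"

text \<open>In units of \<open>\<gamma>\<^sup>2\<close>, in which the Gaussian centres of a monomial are its exponents.\<close>

definition cut :: real where
  "cut = (real (card I) - 1 / 2) * real p"

lemma finite_split_edges: "finite split_edges"
  using finite_parts by (simp add: split_edges_def)

lemma split_poly_in_span: "split_poly \<in> monomial_span (I \<union> J) split_exponents"
  unfolding split_poly_def[abs_def] split_exponents_def
  using finite_parts ordered_pairs_subset[of I] ordered_pairs_subset[of J]
  by (intro edge_prod_mult_monomial_in_span) (auto simp: split_edges_def right_exponent_def)

lemma split_exponents_support: "\<forall>m\<in>split_exponents. \<forall>i. i \<notin> I \<union> J \<longrightarrow> m i = 0"
  by (simp add: split_exponents_def edge_exponents_def)

lemma sum_cut_distance_left: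
  assumes m: "m \<in> split_exponents" and S: "S \<subseteq> I"
  shows "real p / 2 * (real (card S))\<^sup>2 \<le> (\<Sum>i\<in>S. side i * (cut - real (m i)))"
proof -
  have fin: "finite S" using S finite_parts finite_subset by blast
  have card_S: "card S \<le> card I" using S finite_parts by (simp add: card_mono)
  have "split_edges - (- S) \<times> (- S) = ordered_pairs I - ordered_pairs (I - S)"
    using S disjoint by (auto simp: split_edges_def ordered_pairs_def)
  moreover have "ordered_pairs (I - S) \<subseteq> ordered_pairs I" by (auto simp: ordered_pairs_def)
  ultimately have "real (card (split_edges - (- S) \<times> (- S)))
      = real (card (ordered_pairs I)) - real (card (ordered_pairs (I - S)))"
    using finite_parts by (simp add: card_Diff_subset of_nat_diff card_mono)
  moreover have "real (card (I - S)) = real (card I) - real (card S)"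
    using S fin card_S by (simp add: card_Diff_subset of_nat_diff)
  then have "2 * real (card (ordered_pairs (I - S)))
      = (real (card I) - real (card S)) * (real (card I) - real (card S) - 1)"
    using card_ordered_pairs[of "I - S"] finite_parts by simp
  ultimately have edges: "2 * real (card (split_edges - (- S) \<times> (- S)))
      = real (card S) * (2 * real (card I) - real (card S) - 1)"
    using card_ordered_pairs[OF finite_parts(1)] by (simp add: algebra_simps)
  have "sum right_exponent S = 0"
    using S disjoint by (intro sum.neutral) (auto simp: right_exponent_def)
  then have "sum m S \<le> p * card (split_edges - (- S) \<times> (- S))"
    using edge_exponentsD(3)[OF m[unfolded split_exponents_def], of S] S by auto
  then have "2 * (\<Sum>i\<in>S. real (m i)) \<le> real p * (2 * real (card (split_edges - (- S) \<times> (- S))))"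
    by (simp flip: of_nat_mult of_nat_sum)
  moreover have "(\<Sum>i\<in>S. side i * (cut - real (m i))) = real (card S) * cut - (\<Sum>i\<in>S. real (m i))"
    using S by (simp add: side_def subset_iff sum_subtractf)
  ultimately show ?thesis
    unfolding edges cut_def by (simp add: algebra_simps power2_eq_square)
qed

lemma sum_cut_distance_right:
  assumes m: "m \<in> split_exponents" and S: "S \<subseteq> J"
  shows "real p / 2 * (real (card S))\<^sup>2 \<le> (\<Sum>i\<in>S. side i * (cut - real (m i)))"
proof -
  have fin: "finite S" using S finite_parts finite_subset by blast
  have "split_edges \<inter> S \<times> S = ordered_pairs S"
    using S disjoint by (auto simp: split_edges_def ordered_pairs_def)
  then have edges: "2 * real (card (split_edges \<inter> S \<times> S)) = real (card S) * (real (card S) - 1)"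
    using card_ordered_pairs[OF fin] by simp
  have "sum right_exponent S = (\<Sum>i\<in>S. p * card I)"
    using S by (intro sum.cong) (auto simp: right_exponent_def)
  then have "p * card (split_edges \<inter> S \<times> S) + card S * (p * card I) \<le> sum m S"
    using edge_exponentsD(2)[OF m[unfolded split_exponents_def], of S] S by auto
  then have "real (2 * (p * card (split_edges \<inter> S \<times> S) + card S * (p * card I)))
      \<le> real (2 * sum m S)"
    by (simp only: of_nat_le_iff mult_le_mono2)
  then have "real p * (2 * real (card (split_edges \<inter> S \<times> S))) + 2 * real (card S) * real p
      * real (card I)
      \<le> 2 * (\<Sum>i\<in>S. real (m i))"
    by (simp add: algebra_simps)
  moreover have "(\<Sum>i\<in>S. side i * (cut - real (m i))) = (\<Sum>i\<in>S. real (m i)) - real (card S) * cut"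
  proof -
    have "side i = - 1" if "i \<in> S" for i using that S disjoint by (auto simp: side_def)
    then show ?thesis by (simp add: sum_subtractf)
  qed
  ultimately show ?thesis
    unfolding edges cut_def by (simp add: algebra_simps power2_eq_square)
qed

definition labelling :: "('i \<Rightarrow> nat) \<Rightarrow> ('i \<Rightarrow> nat) \<Rightarrow> bool" where
  "labelling m lab \<longleftrightarrow> bij_betw lab I {1..card I} \<and> bij_betw lab J {1..card J}
    \<and> (\<forall>i\<in>I \<union> J. real p / 2 * real (lab i) \<le> side i * (cut - real (m i)))"

lemma labelling_exists:
  assumes m: "m \<in> split_exponents"
  shows "\<exists>lab. labelling m lab"
proof -
  obtain labI where labI: "bij_betw labI I {1..card I}"
      "\<forall>i\<in>I. real p / 2 * real (labI i) \<le> side i * (cut - real (m i))"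
    using labelling_of_quadratic_sums[OF finite_parts(1) sum_cut_distance_left[OF m]] by blast
  obtain labJ where labJ: "bij_betw labJ J {1..card J}"
      "\<forall>i\<in>J. real p / 2 * real (labJ i) \<le> side i * (cut - real (m i))"
    using labelling_of_quadratic_sums[OF finite_parts(2) sum_cut_distance_right[OF m]] by blast
  define lab where "lab i = (if i \<in> I then labI i else labJ i)" for i
  have lab: "\<And>i. i \<in> I \<Longrightarrow> lab i = labI i" "\<And>i. i \<in> J \<Longrightarrow> lab i = labJ i"
    using disjoint by (auto simp: lab_def)
  then have "bij_betw lab I {1..card I}" "bij_betw lab J {1..card J}"
    using labI(1) labJ(1) by (simp_all cong: bij_betw_cong)
  then show ?thesis
    using labI(2) labJ(2) lab by (intro exI[of _ lab]) (auto simp: labelling_def)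
qed

lemma labelling_sum_le:
  fixes f :: "nat \<Rightarrow> real"
  assumes lab: "labelling m lab" and f: "summable f" "\<And>r. 0 \<le> f r"
  shows "(\<Sum>i\<in>I \<union> J. f (lab i)) \<le> 2 * suminf f"
proof -
  have "(\<Sum>i\<in>I \<union> J. f (lab i)) = (\<Sum>i\<in>I. f (lab i)) + (\<Sum>i\<in>J. f (lab i))"
    using finite_parts disjoint by (rule sum.union_disjoint)
  also have "\<dots> = sum f {1..card I} + sum f {1..card J}"
    using lab sum.reindex_bij_betw[of lab I "{1..card I}" f]
      sum.reindex_bij_betw[of lab J "{1..card J}" f]
    unfolding labelling_def by argo
  also have "\<dots> \<le> suminf f + suminf f"
    using f by (intro add_mono sum_le_suminf) auto
  finally show ?thesis by simp
qed

lemma cmod_edge_prod_split: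
  "cmod (full_poly x)
    = cmod (edge_prod p split_edges x) * (\<Prod>i\<in>I. \<Prod>j\<in>J. cmod (x j - x i) ^ p)"
proof -
  define cross where "cross = {(i, j) \<in> ordered_pairs (I \<union> J). i \<in> I \<longleftrightarrow> j \<notin> I}"
  have "finite (ordered_pairs (I \<union> J))" using finite_parts by simp
  then have cross: "finite cross" by (rule rev_finite_subset) (auto simp: cross_def)
  have pairs: "ordered_pairs (I \<union> J) = split_edges \<union> cross" "split_edges \<inter> cross = {}"
    using disjoint by (auto simp: split_edges_def cross_def ordered_pairs_def)
  have "cmod (full_poly x)
      = cmod (edge_prod p split_edges x) * (\<Prod>(i, j)\<in>cross. cmod (x j - x i) ^ p)"
    unfolding cmod_edge_prod pairs(1)
    by (rule prod.union_disjoint[OF finite_split_edges cross pairs(2)])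
  also have "(\<Prod>(i, j)\<in>cross. cmod (x j - x i) ^ p) = (\<Prod>(i, j)\<in>I \<times> J. cmod (x j - x i) ^ p)"
    by (rule prod.reindex_bij_witness[of _ "\<lambda>(i, j). if i < j then (i, j) else (j, i)"
          "\<lambda>(i, j). if i \<in> I then (i, j) else (j, i)"])
       (use disjoint in \<open>auto simp: cross_def ordered_pairs_def norm_minus_commute not_less le_less
         split: if_splits\<close>)
  also have "\<dots> = (\<Prod>i\<in>I. \<Prod>j\<in>J. cmod (x j - x i) ^ p)"
    by (simp add: prod.cartesian_product)
  finally show ?thesis .
qed

lemma cmod_split_poly:
  "cmod (split_poly x) = cmod (edge_prod p split_edges x) * (\<Prod>i\<in>I. \<Prod>j\<in>J. cmod (x j) ^ p)"
proof -
  have "monomial (I \<union> J) right_exponent x = (\<Prod>j\<in>J. x j ^ (p * card I))"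
    unfolding monomial_def using finite_parts
    by (intro prod.mono_neutral_cong_right) (auto simp: right_exponent_def)
  also have "\<dots> = (\<Prod>i\<in>I. \<Prod>j\<in>J. x j ^ p)"
    by (simp add: power_mult prod_power_distrib)
  finally show ?thesis
    by (simp add: split_poly_def norm_mult norm_power flip: prod_norm)
qed

lemma split_poly_nonzero:
  assumes "inj_on x (I \<union> J)" "\<And>i. i \<in> I \<union> J \<Longrightarrow> x i \<noteq> 0"
  shows "split_poly x \<noteq> 0"
proof -
  have "x j - x i \<noteq> 0" if "(i, j) \<in> split_edges" for i j
    using assms(1) that by (auto simp: split_edges_def ordered_pairs_def inj_on_def)
  then have "edge_prod p split_edges x \<noteq> 0"
    using finite_split_edges by (auto simp: edge_prod_def)
  moreover have "monomial (I \<union> J) right_exponent x \<noteq> 0"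
    using assms(2) finite_parts by (auto simp: monomial_def)
  ultimately show ?thesis by (simp add: split_poly_def)
qed

lemma edge_prod_le_split_poly:
  assumes "\<And>j. j \<in> J \<Longrightarrow> x j \<noteq> 0"
  shows "(cmod (full_poly x))\<^sup>2
    \<le> (cmod (split_poly x))\<^sup>2 * exp (2 * real p * (\<Sum>i\<in>I. \<Sum>j\<in>J. cmod (x i) / cmod (x j)))"
proof -
  define interaction where "interaction = (\<Sum>i\<in>I. \<Sum>j\<in>J. cmod (x i) / cmod (x j))"
  have factor: "cmod (x j - x i) ^ p \<le> cmod (x j) ^ p * exp (real p * (cmod (x i) / cmod (x j)))"
    if "j \<in> J" for i j
  proof -
    have pos: "cmod (x j) > 0" using that assms by auto
    have "cmod (x j - x i) \<le> cmod (x j) + cmod (x i)" by (rule norm_triangle_ineq4)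
    also have "\<dots> = cmod (x j) * (1 + cmod (x i) / cmod (x j))" using pos by (simp add: field_simps)
    also have "\<dots> \<le> cmod (x j) * exp (cmod (x i) / cmod (x j))"
      by (intro mult_left_mono exp_ge_add_one_self) auto
    finally have "cmod (x j - x i) ^ p \<le> (cmod (x j) * exp (cmod (x i) / cmod (x j))) ^ p"
      by (intro power_mono) auto
    then show ?thesis by (simp only: power_mult_distrib exp_of_nat_mult)
  qed
  have "(\<Prod>i\<in>I. \<Prod>j\<in>J. cmod (x j - x i) ^ p)
      \<le> (\<Prod>i\<in>I. \<Prod>j\<in>J. cmod (x j) ^ p * exp (real p * (cmod (x i) / cmod (x j))))"
    using factor by (intro prod_mono conjI prod_nonneg) auto
  also have "\<dots> = (\<Prod>i\<in>I. \<Prod>j\<in>J. cmod (x j) ^ p) * exp (real p * interaction)"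
    using finite_parts by (simp add: interaction_def prod.distrib exp_sum sum_distrib_left)
  finally have "cmod (full_poly x) \<le> cmod (split_poly x) * exp (real p * interaction)"
    unfolding cmod_edge_prod_split cmod_split_poly mult.assoc by (rule mult_left_mono) simp
  then have "(cmod (full_poly x))\<^sup>2
    \<le> (cmod (split_poly x) * exp (real p * interaction))\<^sup>2"
    by (intro power_mono) auto
  also have "\<dots> = (cmod (split_poly x))\<^sup>2 * exp (2 * real p * interaction)"
    by (simp add: power_mult_distrib mult.assoc flip: exp_double)
  finally show ?thesis unfolding interaction_def .
qed

definition cross_poly :: "('i \<Rightarrow> complex) \<Rightarrow> complex poly" where
  "cross_poly x = (\<Prod>i\<in>I. \<Prod>j\<in>J. [:x j, - x i:] ^ p)"

lemma degree_cross_poly: "degree (cross_poly x) \<le> card I * (card J * p)"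
proof -
  have "degree (\<Prod>j\<in>J. [:x j, - x i:] ^ p) \<le> (\<Sum>j\<in>J. degree ([:x j, - x i:] ^ p))" for i
    using degree_prod_sum_le[OF finite_parts(2)] by (simp add: o_def)
  also have "(\<Sum>j\<in>J. degree ([:x j, - x i:] ^ p)) \<le> (\<Sum>j\<in>J. p)" for i
    by (intro sum_mono order.trans[OF degree_power_le]) simp
  finally have "(\<Sum>i\<in>I. degree (\<Prod>j\<in>J. [:x j, - x i:] ^ p)) \<le> (\<Sum>i\<in>I. \<Sum>j\<in>J. p)"
    by (rule sum_mono)
  moreover have "degree (cross_poly x) \<le> (\<Sum>i\<in>I. degree (\<Prod>j\<in>J. [:x j, - x i:] ^ p))"
    unfolding cross_poly_def
    using degree_prod_sum_le[OF finite_parts(1)] by (simp add: o_def)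
  ultimately show ?thesis by simp
qed

lemma cmod_poly_cross_poly: "cmod (poly (cross_poly x) w) = (\<Prod>i\<in>I. \<Prod>j\<in>J. cmod (x j - w * x i) ^ p)"
  by (simp add: cross_poly_def poly_prod norm_power flip: prod_norm)

lemma cmod_edge_prod_scale_left:
  assumes w: "cmod w = 1"
  shows "cmod (full_poly (scale_on I (\<lambda>_. w) x))
    = cmod (edge_prod p split_edges x) * cmod (poly (cross_poly x) w)"
proof -
  have "cmod (edge_prod p split_edges (scale_on I (\<lambda>_. w) x)) = cmod (edge_prod p split_edges x)"
    unfolding cmod_edge_prod
  proof (intro prod.cong refl, safe)
    fix i j assume "(i, j) \<in> split_edges"
    then have "i \<in> I \<longleftrightarrow> j \<in> I" using disjoint by (auto simp: split_edges_def ordered_pairs_def)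
    then show "cmod (scale_on I (\<lambda>_. w) x j - scale_on I (\<lambda>_. w) x i) ^ p = cmod (x j - x i) ^ p"
      using w by (simp add: scale_on_def norm_mult flip: right_diff_distrib)
  qed
  moreover have "scale_on I (\<lambda>_. w) x i = w * x i" if "i \<in> I" for i
    using that by (simp add: scale_on_def)
  moreover have "scale_on I (\<lambda>_. w) x j = x j" if "j \<in> J" for j
    using that disjoint by (auto simp: scale_on_def)
  ultimately show ?thesis
    unfolding cmod_edge_prod_split cmod_poly_cross_poly by simp
qed

lemma mean_rotation_ge_split_poly:
  assumes "card I * (card J * p) < q"
  shows "real q * (cmod (split_poly x))\<^sup>2
    \<le> (\<Sum>s<q. (cmod (full_poly (scale_on I (\<lambda>_. unity_root q s) x)))\<^sup>2)"
proof -
  have "real q * (cmod (split_poly x))\<^sup>2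
      = (cmod (edge_prod p split_edges x))\<^sup>2 * (real q * (cmod (poly (cross_poly x) 0))\<^sup>2)"
    by (simp add: cmod_split_poly cmod_poly_cross_poly power_mult_distrib)
  also have "\<dots>
      \<le> (cmod (edge_prod p split_edges x))\<^sup>2
          * (\<Sum>s<q. (cmod (poly (cross_poly x) (unity_root q s)))\<^sup>2)"
    using degree_cross_poly[of x] assms by (intro mult_left_mono mean_square_ge_value_at_0) auto
  also have "\<dots> = (\<Sum>s<q. (cmod (full_poly (scale_on I (\<lambda>_. unity_root q s) x)))\<^sup>2)"
    by (simp add: cmod_edge_prod_scale_left power_mult_distrib sum_distrib_left)
  finally show ?thesis .
qed

lemma cyl_norm_square_split_poly_le:
  assumes R: "R > 0" and h: "(\<lambda>z. h (Re \<circ> z)) \<in> borel_measurable (cyl_config R (I \<union> J))"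
  shows "cyl_norm_square R (I \<union> J) h split_poly
    \<le> cyl_norm_square R (I \<union> J) h full_poly"
proof -
  define q where "q = Suc (card I * (card J * p))"
  then have q: "card I * (card J * p) < q" "0 < q" by simp_all
  have "(cmod (split_poly x))\<^sup>2
      \<le> (\<Sum>s<q. (cmod (full_poly (scale_on I (\<lambda>_. unity_root q s) x)))\<^sup>2) / real q" for x
    using mean_rotation_ge_split_poly[OF q(1), of x] q(2)
    by (simp add: pos_le_divide_eq mult.commute)
  then have "cyl_norm_square R (I \<union> J) h split_poly
      \<le> (\<integral>\<^sup>+z. ennreal ((\<Sum>s<q. (cmod (full_poly (scale_on I (\<lambda>_. unity_root q s) (exp_coord R z))))\<^sup>2)
          / real (card {..<q})) * h (Re \<circ> z) \<partial>cyl_config R (I \<union> J))"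
    unfolding cyl_norm_square_def by (intro nn_integral_mono mult_right_mono ennreal_leI) auto
  also have "\<dots> = cyl_norm_square R (I \<union> J) h full_poly"
    by (rule nn_integral_mean_over_rotations[OF _ _ R edge_prod_measurable[OF ordered_pairs_subset] h])
      (use finite_parts q(2) in auto)
  finally show ?thesis .
qed

end

section \<open>Bounding the interaction across a cut\<close>

lemma card_labels_le:
  fixes lab :: "'i \<Rightarrow> nat"
  assumes "inj_on lab I" "\<And>i. i \<in> I \<Longrightarrow> 1 \<le> lab i" and x: "0 \<le> x"
  shows "real (card {i\<in>I. real (lab i) \<le> x}) \<le> x"
proof -
  have "card {i\<in>I. real (lab i) \<le> x} = card (lab ` {i\<in>I. real (lab i) \<le> x})"
    using assms(1) by (intro card_image[symmetric]) (auto intro: inj_on_subset)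
  also have "\<dots> \<le> card {1..nat \<lfloor>x\<rfloor>}"
    using assms(2) by (intro card_mono) (auto simp: le_nat_floor)
  finally have "real (card {i\<in>I. real (lab i) \<le> x}) \<le> real (nat \<lfloor>x\<rfloor>)" by simp
  also have "\<dots> \<le> x" using x by simp
  finally show ?thesis .
qed

lemma sum_squared_le_labelled_sum:
  fixes w :: "'i \<Rightarrow> real" and lab :: "'i \<Rightarrow> nat"
  assumes I: "finite I" and lab: "inj_on lab I" "\<And>i. i \<in> I \<Longrightarrow> 1 \<le> lab i"
    and w: "\<And>i. i \<in> I \<Longrightarrow> 0 \<le> w i \<and> w i \<le> 1"
  shows "(\<Sum>i\<in>I. w i)\<^sup>2 \<le> 2 * (\<Sum>i\<in>I. real (lab i) * w i)"
proof -
  let ?below = "\<lambda>i j. if lab j \<le> lab i then w i else 0"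
  have "(\<Sum>i\<in>I. w i)\<^sup>2 = (\<Sum>i\<in>I. \<Sum>j\<in>I. w i * w j)"
    by (simp add: power2_eq_square sum_product)
  also have "\<dots> \<le> (\<Sum>i\<in>I. \<Sum>j\<in>I. ?below i j + ?below j i)"
  proof (intro sum_mono)
    fix i j assume "i \<in> I" "j \<in> I"
    then have "w i * w j \<le> w i" "w i * w j \<le> w j" "0 \<le> w i" "0 \<le> w j"
      using w by (auto intro: mult_left_le mult_left_le_one_le)
    then show "w i * w j \<le> ?below i j + ?below j i" by auto
  qed
  also have "\<dots> = 2 * (\<Sum>i\<in>I. \<Sum>j\<in>I. ?below i j)"
    using sum.swap[of "\<lambda>i j. ?below j i" I I] by (simp add: sum.distrib)
  also have "(\<Sum>i\<in>I. \<Sum>j\<in>I. ?below i j) \<le> (\<Sum>i\<in>I. real (lab i) * w i)"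
  proof (rule sum_mono)
    fix i assume i: "i \<in> I"
    have "(\<Sum>j\<in>I. ?below i j) = real (card {j\<in>I. real (lab j) \<le> real (lab i)}) * w i"
      using I by (simp add: sum.If_cases Int_def)
    also have "\<dots> \<le> real (lab i) * w i"
      using card_labels_le[OF lab, where x="real (lab i)"] w[OF i] by (intro mult_right_mono) auto
    finally show "(\<Sum>j\<in>I. ?below i j) \<le> real (lab i) * w i" .
  qed
  finally show ?thesis by simp
qed

definition overlap :: "real \<Rightarrow> ('i \<Rightarrow> nat) \<Rightarrow> ('i \<Rightarrow> real) \<Rightarrow> 'i set \<Rightarrow> real" where
  "overlap \<epsilon> lab y I = (\<Sum>i\<in>I. min 1 (exp (\<epsilon> * real (lab i) + y i)))"

lemma overlap_nonneg: "0 \<le> overlap \<epsilon> lab y I"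
  unfolding overlap_def by (rule sum_nonneg) simp

lemma sum_exp_le_overlap:
  assumes "0 \<le> \<epsilon>" "0 \<le> s" and "\<And>i. i \<in> I \<Longrightarrow> y i \<le> s"
  shows "(\<Sum>i\<in>I. exp (y i - s)) \<le> overlap \<epsilon> lab y I"
  unfolding overlap_def
proof (rule sum_mono)
  fix i assume "i \<in> I"
  moreover have "0 \<le> \<epsilon> * real (lab i)" using assms by simp
  ultimately show "exp (y i - s) \<le> min 1 (exp (\<epsilon> * real (lab i) + y i))"
    using assms by (simp; linarith)
qed

lemma sum_exp_le_depth_add_overlap:
  assumes J: "finite J" and lab: "inj_on lab J" "\<And>j. j \<in> J \<Longrightarrow> 1 \<le> lab j"
    and \<epsilon>: "0 < \<epsilon>" and s: "0 \<le> s" "\<And>j. j \<in> J \<Longrightarrow> y j \<le> - s"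
  shows "(\<Sum>j\<in>J. exp (y j + s)) \<le> s / \<epsilon> + overlap \<epsilon> lab y J"
proof -
  have "(\<Sum>j\<in>J. exp (y j + s))
      \<le> (\<Sum>j\<in>J. (if real (lab j) \<le> s / \<epsilon> then 1 else 0) + min 1 (exp (\<epsilon> * real (lab j) + y j)))"
  proof (rule sum_mono)
    fix j assume j: "j \<in> J"
    show "exp (y j + s)
        \<le> (if real (lab j) \<le> s / \<epsilon> then 1 else 0) + min 1 (exp (\<epsilon> * real (lab j) + y j))"
    proof (cases "real (lab j) \<le> s / \<epsilon>")
      case True
      have "exp (y j + s) \<le> 1" using s(2)[OF j] by simp
      then show ?thesis using True by (simp add: add_increasing2)
    next
      case False
      then have "s \<le> \<epsilon> * real (lab j)" using \<epsilon> by (simp add: field_simps)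
      then show ?thesis using False s(2)[OF j] by simp
    qed
  qed
  also have "\<dots> = real (card {j\<in>J. real (lab j) \<le> s / \<epsilon>}) + overlap \<epsilon> lab y J"
    using J by (simp add: sum.distrib overlap_def sum.If_cases Int_def)
  also have "\<dots> \<le> s / \<epsilon> + overlap \<epsilon> lab y J"
    using card_labels_le[OF lab, where x="s / \<epsilon>"] s(1) \<epsilon> by simp
  finally show ?thesis .
qed

lemma mult_shifted_le_squares:
  fixes A B s P \<epsilon> \<eta> :: real
  assumes "0 < \<epsilon>" "0 < \<eta>" "0 \<le> P"
  shows "P * (A * (s / \<epsilon> + B)) \<le> (P / 2 + P\<^sup>2 / (4 * \<eta> * \<epsilon>\<^sup>2)) * (A\<^sup>2 + B\<^sup>2) + \<eta> * s\<^sup>2"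
proof -
  have "0 \<le> (P * A / \<epsilon> - 2 * \<eta> * s)\<^sup>2 / (4 * \<eta>)" using assms by simp
  also have "\<dots> = P\<^sup>2 / (4 * \<eta> * \<epsilon>\<^sup>2) * A\<^sup>2 + \<eta> * s\<^sup>2 - P * A * s / \<epsilon>"
    using assms by (simp add: power2_eq_square field_simps)
  finally have "P * A * s / \<epsilon> \<le> P\<^sup>2 / (4 * \<eta> * \<epsilon>\<^sup>2) * A\<^sup>2 + \<eta> * s\<^sup>2" by simp
  moreover have "P * (A * B) \<le> P * ((A\<^sup>2 + B\<^sup>2) / 2)"
    using assms sum_squares_bound[of A B] by (intro mult_left_mono) auto
  moreover have "0 \<le> P\<^sup>2 / (4 * \<eta> * \<epsilon>\<^sup>2) * B\<^sup>2" using assms by simp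
  ultimately show ?thesis by (simp add: algebra_simps add_divide_distrib)
qed

context
  fixes lab :: "'i \<Rightarrow> nat" and y :: "'i \<Rightarrow> real" and P \<epsilon> \<eta> :: real
  assumes pos: "0 < \<epsilon>" "0 < \<eta>" "0 \<le> P"
begin

text \<open>Cutting at the largest positive coordinate \<open>s\<close> costs \<open>\<eta> s\<^sup>2\<close>, which is paid for by the particle
  sitting there.\<close>

lemma interaction_bound_one_sided:
  assumes fin: "finite I" "finite J" and lab: "inj_on lab J" "\<And>j. j \<in> J \<Longrightarrow> 1 \<le> lab j"
    and ordered: "\<And>i j. i \<in> I \<Longrightarrow> j \<in> J \<Longrightarrow> y i + y j \<le> 0" and nonpos: "\<And>j. j \<in> J \<Longrightarrow> y j \<le> 0"
  shows "P * (\<Sum>i\<in>I. \<Sum>j\<in>J. exp (y i + y j))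
    \<le> (P / 2 + P\<^sup>2 / (4 * \<eta> * \<epsilon>\<^sup>2)) * ((overlap \<epsilon> lab y I)\<^sup>2 + (overlap \<epsilon> lab y J)\<^sup>2)
      + \<eta> * (\<Sum>i\<in>I. (max 0 (y i))\<^sup>2)"
proof -
  define s where "s = Max (insert 0 (y ` I))"
  have s: "0 \<le> s" "\<And>i. i \<in> I \<Longrightarrow> y i \<le> s" using fin by (auto simp: s_def)
  have "s \<in> insert 0 (y ` I)" unfolding s_def by (rule Max_in) (use fin in auto)
  then consider "s = 0" | i where "i \<in> I" "s = y i" by auto
  then have "(\<forall>j\<in>J. y j \<le> - s) \<and> s\<^sup>2 \<le> (\<Sum>i\<in>I. (max 0 (y i))\<^sup>2)"
  proof cases
    case 1
    then show ?thesis using nonpos by (simp add: sum_nonneg)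
  next
    case 2
    have "y j \<le> - s" if "j \<in> J" for j using ordered[OF 2(1) that] 2(2) by simp
    moreover have "s\<^sup>2 \<le> (\<Sum>i\<in>I. (max 0 (y i))\<^sup>2)"
      using member_le_sum[OF 2(1), of "\<lambda>i. (max 0 (y i))\<^sup>2"] fin s(1) 2(2) by simp
    ultimately show ?thesis by blast
  qed
  then have J_le: "\<And>j. j \<in> J \<Longrightarrow> y j \<le> - s" and s_le: "s\<^sup>2 \<le> (\<Sum>i\<in>I. (max 0 (y i))\<^sup>2)"
    by auto
  have "(\<Sum>i\<in>I. \<Sum>j\<in>J. exp (y i + y j)) = (\<Sum>i\<in>I. exp (y i - s)) * (\<Sum>j\<in>J. exp (y j + s))"
    by (simp add: sum_product flip: exp_add)
  also have "\<dots> \<le> overlap \<epsilon> lab y I * (s / \<epsilon> + overlap \<epsilon> lab y J)"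
    using pos s J_le lab fin
    by (intro mult_mono sum_exp_le_overlap sum_exp_le_depth_add_overlap overlap_nonneg sum_nonneg)
      auto
  finally have "P * (\<Sum>i\<in>I. \<Sum>j\<in>J. exp (y i + y j))
      \<le> P * (overlap \<epsilon> lab y I * (s / \<epsilon> + overlap \<epsilon> lab y J))"
    using pos by (intro mult_left_mono)
  also have "\<dots>
      \<le> (P / 2 + P\<^sup>2 / (4 * \<eta> * \<epsilon>\<^sup>2)) * ((overlap \<epsilon> lab y I)\<^sup>2 + (overlap \<epsilon> lab y J)\<^sup>2) + \<eta> * s\<^sup>2"
    using pos by (intro mult_shifted_le_squares)
  also have "\<eta> * s\<^sup>2 \<le> \<eta> * (\<Sum>i\<in>I. (max 0 (y i))\<^sup>2)"
    using pos s_le by (intro mult_left_mono) auto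
  finally show ?thesis by simp
qed

lemma interaction_bound:
  assumes fin: "finite I" "finite J"
    and lab: "inj_on lab I" "inj_on lab J" "\<And>i. i \<in> I \<union> J \<Longrightarrow> 1 \<le> lab i"
    and ordered: "\<And>i j. i \<in> I \<Longrightarrow> j \<in> J \<Longrightarrow> y i + y j \<le> 0"
  shows "P * (\<Sum>i\<in>I. \<Sum>j\<in>J. exp (y i + y j))
    \<le> (P / 2 + P\<^sup>2 / (4 * \<eta> * \<epsilon>\<^sup>2)) * ((overlap \<epsilon> lab y I)\<^sup>2 + (overlap \<epsilon> lab y J)\<^sup>2)
      + \<eta> * ((\<Sum>i\<in>I. (max 0 (y i))\<^sup>2) + (\<Sum>j\<in>J. (max 0 (y j))\<^sup>2))"
proof -
  have nonneg: "0 \<le> \<eta> * (\<Sum>i\<in>S. (max 0 (y i))\<^sup>2)" for S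
    using pos by (simp add: sum_nonneg)
  show ?thesis
  proof (cases "\<forall>j\<in>J. y j \<le> 0")
    case True
    then show ?thesis
      using interaction_bound_one_sided[OF fin lab(2), OF _ ordered] lab(3) nonneg[of J]
      by (simp add: algebra_simps)
  next
    case False
    then obtain j where "j \<in> J" "0 < y j" by auto
    then have nonpos: "y i \<le> 0" if "i \<in> I" for i using ordered[OF that \<open>j \<in> J\<close>] by simp
    have swapped: "y j + y i \<le> 0" if "j \<in> J" "i \<in> I" for j i
      using ordered[OF that(2,1)] by simp
    have "(\<Sum>i\<in>I. \<Sum>j\<in>J. exp (y i + y j)) = (\<Sum>j\<in>J. \<Sum>i\<in>I. exp (y j + y i))"
      by (subst sum.swap) (simp add: add.commute)
    then show ?thesis
      using interaction_bound_one_sided[OF fin(2,1) lab(1), OF _ swapped nonpos] lab(3) nonneg[of I]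
      by (simp add: algebra_simps)
  qed
qed

end

definition site_weight :: "real \<Rightarrow> real \<Rightarrow> real \<Rightarrow> nat \<Rightarrow> real \<Rightarrow> real" where
  "site_weight L \<epsilon> \<eta> r y = exp (L * real r * min 1 (exp (\<epsilon> * real r + y)) + \<eta> * (max 0 y)\<^sup>2)"

lemma site_weight_nonneg: "0 \<le> site_weight L \<epsilon> \<eta> r y"
  by (simp add: site_weight_def)

lemma site_weight_measurable [measurable]: "site_weight L \<epsilon> \<eta> r \<in> borel_measurable borel"
  unfolding site_weight_def by measurable

lemma interaction_le_site_weights:
  fixes lab :: "'i \<Rightarrow> nat" and y :: "'i \<Rightarrow> real"
  assumes fin: "finite I" "finite J" and disjoint: "I \<inter> J = {}"
    and lab: "inj_on lab I" "inj_on lab J" "\<And>i. i \<in> I \<union> J \<Longrightarrow> 1 \<le> lab i"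
    and ordered: "\<And>i j. i \<in> I \<Longrightarrow> j \<in> J \<Longrightarrow> y i + y j \<le> 0"
    and pos: "0 < \<epsilon>" "0 < \<eta>" "0 \<le> P" and L: "L = P + P\<^sup>2 / (2 * \<eta> * \<epsilon>\<^sup>2)"
  shows "exp (P * (\<Sum>i\<in>I. \<Sum>j\<in>J. exp (y i + y j))) \<le> (\<Prod>i\<in>I \<union> J. site_weight L \<epsilon> \<eta> (lab i) (y i))"
proof -
  define K where "K = P / 2 + P\<^sup>2 / (4 * \<eta> * \<epsilon>\<^sup>2)"
  have K: "0 \<le> K" "L = 2 * K" using pos by (simp_all add: K_def L)
  define weight where "weight i
      = L * real (lab i) * min 1 (exp (\<epsilon> * real (lab i) + y i)) + \<eta> * (max 0 (y i))\<^sup>2" for i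
  have overlap_le: "K * (overlap \<epsilon> lab y S)\<^sup>2 + \<eta> * (\<Sum>i\<in>S. (max 0 (y i))\<^sup>2) \<le> sum weight S"
    if "finite S" "inj_on lab S" "\<And>i. i \<in> S \<Longrightarrow> 1 \<le> lab i" for S
  proof -
    have "K * (overlap \<epsilon> lab y S)\<^sup>2
        \<le> K * (2 * (\<Sum>i\<in>S. real (lab i) * min 1 (exp (\<epsilon> * real (lab i) + y i))))"
      unfolding overlap_def using K(1) that
      by (intro mult_left_mono sum_squared_le_labelled_sum) auto
    then show ?thesis
      by (simp add: weight_def K(2) sum.distrib sum_distrib_left mult_ac)
  qed
  have "P * (\<Sum>i\<in>I. \<Sum>j\<in>J. exp (y i + y j)) \<le> sum weight I + sum weight J"
    using interaction_bound[where y=y, OF pos fin lab ordered] overlap_le[OF fin(1) lab(1)]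
      overlap_le[OF fin(2) lab(2)] lab(3)
    unfolding K_def[symmetric] by (simp add: distrib_left)
  also have "\<dots> = sum weight (I \<union> J)"
    using fin disjoint by (rule sum.union_disjoint[symmetric])
  finally show ?thesis
    using fin by (simp add: site_weight_def weight_def flip: exp_sum)
qed

section \<open>Gaussian estimates\<close>

definition normal_law :: "real \<Rightarrow> real \<Rightarrow> real measure" where
  "normal_law \<nu> s = density lborel (\<lambda>t. ennreal (normal_density \<nu> s t))"

lemma sets_normal_law [measurable_cong, simp]: "sets (normal_law \<nu> s) = sets borel"
  by (simp add: normal_law_def)

lemma space_normal_law [simp]: "space (normal_law \<nu> s) = UNIV"
  by (simp add: normal_law_def)

lemma nn_integral_normal_law:
  "f \<in> borel_measurable borel \<Longrightarrow>
    (\<integral>\<^sup>+t. f t \<partial>normal_law \<nu> s) = (\<integral>\<^sup>+t. ennreal (normal_density \<nu> s t) * f t \<partial>lborel)"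
  unfolding normal_law_def by (rule nn_integral_density) auto

lemma prob_space_normal_law: "0 < s \<Longrightarrow> prob_space (normal_law \<nu> s)"
  unfolding normal_law_def by (rule prob_space_normal_density)

lemma nn_integral_normal_density: "0 < s \<Longrightarrow> (\<integral>\<^sup>+t. ennreal (normal_density \<nu> s t) \<partial>lborel) = 1"
  using prob_space.emeasure_space_1[OF prob_space_normal_law, of s \<nu>]
  by (simp add: normal_law_def emeasure_density)

lemma measure_normal_law_neg:
  assumes "0 < s"
  shows "measure (normal_law \<nu> s) {..<0} = 1 - measure (normal_law \<nu> s) {0..}"
proof -
  interpret prob_space "normal_law \<nu> s" using assms by (rule prob_space_normal_law)
  have "{..<0} = space (normal_law \<nu> s) - {0..}" by auto
  then show ?thesis using prob_compl[of "{0..}"] by simp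
qed

lemma measure_normal_law_nonneg:
  assumes "0 < s"
  shows "measure (normal_law 0 s) {0..} = 1 / 2"
proof -
  interpret prob_space "normal_law 0 s" using assms by (rule prob_space_normal_law)
  have "emeasure (normal_law 0 s) {0..}
      = (\<integral>\<^sup>+t. ennreal (normal_density 0 s t) * indicator {0..} t \<partial>lborel)"
    by (simp add: normal_law_def emeasure_density)
  also have "\<dots> = (\<integral>\<^sup>+t. ennreal (normal_density 0 s t) * indicator {..0} t \<partial>lborel)"
    by (subst nn_integral_real_affine[where c="-1" and t=0])
      (auto simp: normal_density_def indicator_def intro!: nn_integral_cong)
  also have "\<dots> = (\<integral>\<^sup>+t. ennreal (normal_density 0 s t) * indicator {..<0} t \<partial>lborel)"
    using AE_lborel_singleton[of "0::real"]
    by (intro nn_integral_cong_AE) (auto simp: indicator_def elim: eventually_mono)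
  also have "\<dots> = emeasure (normal_law 0 s) {..<0}"
    by (simp add: normal_law_def emeasure_density)
  finally have "prob {0..} = prob {..<0}"
    by (simp add: emeasure_eq_measure)
  then show ?thesis using measure_normal_law_neg[OF assms, of 0] by simp
qed

lemma measure_normal_law_tail_le:
  assumes s: "0 < s" and \<nu>: "\<nu> \<le> 0"
  shows "measure (normal_law \<nu> s) {0..} \<le> exp (- (\<nu>\<^sup>2 / (2 * s\<^sup>2))) / 2"
proof -
  interpret N: prob_space "normal_law \<nu> s" using s by (rule prob_space_normal_law)
  interpret N0: prob_space "normal_law 0 s" using s by (rule prob_space_normal_law)
  have "normal_density \<nu> s t \<le> exp (- (\<nu>\<^sup>2 / (2 * s\<^sup>2))) * normal_density 0 s t" if "0 \<le> t" for t
  proof -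
    have "\<nu>\<^sup>2 + t\<^sup>2 \<le> (t - \<nu>)\<^sup>2"
      using that \<nu> by (simp add: power2_diff mult_nonneg_nonpos)
    then have "- (t - \<nu>)\<^sup>2 / (2 * s\<^sup>2) \<le> - (\<nu>\<^sup>2 / (2 * s\<^sup>2)) + - (t\<^sup>2) / (2 * s\<^sup>2)"
      using s by (simp add: field_simps)
    then have "exp (- (t - \<nu>)\<^sup>2 / (2 * s\<^sup>2))
        \<le> exp (- (\<nu>\<^sup>2 / (2 * s\<^sup>2))) * exp (- (t\<^sup>2) / (2 * s\<^sup>2))"
      by (simp flip: exp_add)
    then show ?thesis using s by (simp add: normal_density_def divide_right_mono)
  qed
  then have "emeasure (normal_law \<nu> s) {0..}
      \<le> (\<integral>\<^sup>+t. ennreal (exp (- (\<nu>\<^sup>2 / (2 * s\<^sup>2))))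
          * (ennreal (normal_density 0 s t) * indicator {0..} t) \<partial>lborel)"
    by (auto simp: normal_law_def emeasure_density indicator_def simp flip: ennreal_mult'
      intro!: nn_integral_mono ennreal_leI)
  also have "\<dots> = ennreal (exp (- (\<nu>\<^sup>2 / (2 * s\<^sup>2)))) * emeasure (normal_law 0 s) {0..}"
    by (simp add: normal_law_def emeasure_density nn_integral_cmult)
  finally have "N.prob {0..} \<le> exp (- (\<nu>\<^sup>2 / (2 * s\<^sup>2))) * N0.prob {0..}"
    by (simp add: N.emeasure_eq_measure N0.emeasure_eq_measure flip: ennreal_mult')
  then show ?thesis by (simp add: measure_normal_law_nonneg[OF s])
qed

lemma exp_minus_le_one_minus_half:
  assumes "0 \<le> x" "x \<le> 1"
  shows "exp (- x) \<le> 1 - x / (2::real)"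
proof -
  have "exp (- x) \<le> 1 / (1 + x)"
    using exp_ge_add_one_self[of x] assms by (simp add: exp_minus field_simps)
  also have "\<dots> \<le> 1 - x / 2"
    using assms mult_left_mono[of x 1 x] by (simp add: field_simps)
  finally show ?thesis .
qed

lemma emeasure_normal_law_neg_ge:
  assumes s: "0 < s" and \<tau>: "0 \<le> \<tau>" "\<nu> \<le> - \<tau>"
  shows "ennreal (exp (- exp (- (\<tau>\<^sup>2 / (2 * s\<^sup>2))))) \<le> emeasure (normal_law \<nu> s) {..<0}"
proof -
  interpret prob_space "normal_law \<nu> s" using s by (rule prob_space_normal_law)
  define x where "x = exp (- (\<nu>\<^sup>2 / (2 * s\<^sup>2)))"
  have "\<tau>\<^sup>2 \<le> (- \<nu>)\<^sup>2" using \<tau> by (intro power_mono) auto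
  then have "x \<le> exp (- (\<tau>\<^sup>2 / (2 * s\<^sup>2)))" using s by (simp add: x_def divide_right_mono)
  then have "exp (- exp (- (\<tau>\<^sup>2 / (2 * s\<^sup>2)))) \<le> exp (- x)" by simp
  also have "\<dots> \<le> 1 - x / 2" by (rule exp_minus_le_one_minus_half) (simp_all add: x_def)
  also have "\<dots> \<le> 1 - prob {0..}"
    using measure_normal_law_tail_le[OF s, of \<nu>] \<tau> by (simp add: x_def)
  also have "\<dots> = prob {..<0}"
    using s by (rule measure_normal_law_neg[symmetric])
  finally show ?thesis by (simp add: emeasure_eq_measure)
qed

definition site_error :: "real \<Rightarrow> real \<Rightarrow> real \<Rightarrow> nat \<Rightarrow> real" where
  "site_error L \<epsilon> s r = L * real r * exp (- (\<epsilon> * real r / 2))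
     + sqrt 2 * exp (L * real r - (\<epsilon> * real r)\<^sup>2 / (32 * s\<^sup>2))"

lemma site_error_nonneg: "0 \<le> L \<Longrightarrow> 0 \<le> site_error L \<epsilon> s r"
  by (simp add: site_error_def)

text \<open>For large \<open>r\<close> the weight is close to 1 near the mean; far from it, it at most doubles the variance.\<close>

lemma normal_density_site_weight_near_le:
  assumes \<epsilon>: "0 \<le> \<epsilon>" and L: "0 \<le> L" and \<nu>: "\<nu> \<le> - (2 * \<epsilon> * real r)"
    and near: "t \<le> \<nu> + \<epsilon> * real r / 2"
  shows "normal_density \<nu> s t * site_weight L \<epsilon> \<eta> r t
    \<le> exp (L * real r * exp (- (\<epsilon> * real r / 2))) * normal_density \<nu> s t"
proof -
  have "0 \<le> \<epsilon> * real r" using \<epsilon> by simp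
  then have "max 0 t = 0" using near \<nu> by simp
  moreover have "min 1 (exp (\<epsilon> * real r + t)) \<le> exp (- (\<epsilon> * real r / 2))"
    using near \<nu> by (intro min.coboundedI2) simp
  then have "L * real r * min 1 (exp (\<epsilon> * real r + t)) \<le> L * real r * exp (- (\<epsilon> * real r / 2))"
    using L by (intro mult_left_mono) auto
  ultimately show ?thesis
    by (subst mult.commute) (auto simp: site_weight_def intro!: mult_right_mono)
qed

lemma normal_density_site_weight_far_le:
  assumes s: "0 < s" and \<epsilon>: "0 \<le> \<epsilon>" and L: "0 \<le> L" and \<nu>: "\<nu> \<le> - (2 * \<epsilon> * real r)"
    and far: "\<nu> + \<epsilon> * real r / 2 \<le> t"
  shows "normal_density \<nu> s t * site_weight L \<epsilon> (1 / (8 * s\<^sup>2)) r t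
    \<le> sqrt 2 * exp (L * real r - (\<epsilon> * real r)\<^sup>2 / (32 * s\<^sup>2)) * normal_density \<nu> (sqrt 2 * s) t"
proof -
  define u where "u = t - \<nu>"
  have \<epsilon>r: "0 \<le> \<epsilon> * real r" using \<epsilon> by simp
  have "(max 0 t)\<^sup>2 \<le> u\<^sup>2"
    using far \<nu> \<epsilon>r by (intro power_mono) (auto simp: u_def)
  then have "1 / (8 * s\<^sup>2) * (max 0 t)\<^sup>2 \<le> u\<^sup>2 / (8 * s\<^sup>2)"
    by (simp add: divide_right_mono)
  moreover have "L * real r * min 1 (exp (\<epsilon> * real r + t)) \<le> L * real r"
    using L by (intro mult_left_le) auto
  moreover have "(\<epsilon> * real r / 2)\<^sup>2 \<le> u\<^sup>2" using far \<epsilon>r by (intro power_mono) (auto simp: u_def)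
  then have "(\<epsilon> * real r)\<^sup>2 / (32 * s\<^sup>2) \<le> u\<^sup>2 / (8 * s\<^sup>2)"
    using s by (simp add: field_simps power2_eq_square)
  moreover have "- (u\<^sup>2) / (2 * s\<^sup>2)
      = - (u\<^sup>2) / (2 * (sqrt 2 * s)\<^sup>2) - u\<^sup>2 / (8 * s\<^sup>2) - u\<^sup>2 / (8 * s\<^sup>2)"
    using s by (simp add: power_mult_distrib field_simps)
  ultimately have "- (u\<^sup>2) / (2 * s\<^sup>2)
      + (L * real r * min 1 (exp (\<epsilon> * real r + t)) + 1 / (8 * s\<^sup>2) * (max 0 t)\<^sup>2)
     \<le> L * real r - (\<epsilon> * real r)\<^sup>2 / (32 * s\<^sup>2) + - (u\<^sup>2) / (2 * (sqrt 2 * s)\<^sup>2)"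
    by linarith
  then have "exp (- (u\<^sup>2) / (2 * s\<^sup>2)) * site_weight L \<epsilon> (1 / (8 * s\<^sup>2)) r t
      \<le> exp (L * real r - (\<epsilon> * real r)\<^sup>2 / (32 * s\<^sup>2)) * exp (- (u\<^sup>2) / (2 * (sqrt 2 * s)\<^sup>2))"
    unfolding site_weight_def exp_add[symmetric] by simp
  then have "1 / sqrt (2 * pi * s\<^sup>2)
      * (exp (- (u\<^sup>2) / (2 * s\<^sup>2)) * site_weight L \<epsilon> (1 / (8 * s\<^sup>2)) r t)
      \<le> 1 / sqrt (2 * pi * s\<^sup>2)
        * (exp (L * real r - (\<epsilon> * real r)\<^sup>2 / (32 * s\<^sup>2)) * exp (- (u\<^sup>2) / (2 * (sqrt 2 * s)\<^sup>2)))"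
    by (rule mult_left_mono) simp
  moreover have "sqrt (2 * pi * (sqrt 2 * s)\<^sup>2) = sqrt 2 * sqrt (2 * pi * s\<^sup>2)"
    unfolding real_sqrt_mult[symmetric] by (simp add: power_mult_distrib mult_ac)
  then have "1 / sqrt (2 * pi * s\<^sup>2) = sqrt 2 * (1 / sqrt (2 * pi * (sqrt 2 * s)\<^sup>2))" by simp
  ultimately show ?thesis
    unfolding normal_density_def u_def[symmetric] by (simp only: mult_ac)
qed

lemma nn_integral_site_weight_le:
  assumes s: "0 < s" and \<epsilon>: "0 \<le> \<epsilon>" and L: "0 \<le> L" and \<nu>: "\<nu> \<le> - (2 * \<epsilon> * real r)"
  shows "(\<integral>\<^sup>+t. ennreal (site_weight L \<epsilon> (1 / (8 * s\<^sup>2)) r t) \<partial>normal_law \<nu> s)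
      \<le> ennreal (exp (site_error L \<epsilon> s r))"
proof -
  define near where "near = L * real r * exp (- (\<epsilon> * real r / 2))"
  define far where "far = sqrt 2 * exp (L * real r - (\<epsilon> * real r)\<^sup>2 / (32 * s\<^sup>2))"
  have nonneg: "0 \<le> near" "0 \<le> far" using L by (simp_all add: near_def far_def)
  have pointwise: "normal_density \<nu> s t * site_weight L \<epsilon> (1 / (8 * s\<^sup>2)) r t
      \<le> exp near * normal_density \<nu> s t + far * normal_density \<nu> (sqrt 2 * s) t" for t
  proof (cases "t \<le> \<nu> + \<epsilon> * real r / 2")
    case True
    then show ?thesis
      using normal_density_site_weight_near_le[OF \<epsilon> L \<nu>] nonneg
      unfolding near_def by (intro add_increasing2) simp_all
  next
    case False
    then show ?thesis
      using normal_density_site_weight_far_le[OF s \<epsilon> L \<nu>]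
      unfolding far_def by (intro add_increasing) simp_all
  qed
  have "(\<integral>\<^sup>+t. ennreal (site_weight L \<epsilon> (1 / (8 * s\<^sup>2)) r t) \<partial>normal_law \<nu> s)
      \<le> (\<integral>\<^sup>+t. ennreal (exp near) * ennreal (normal_density \<nu> s t)
          + ennreal far * ennreal (normal_density \<nu> (sqrt 2 * s) t) \<partial>lborel)"
    using pointwise nonneg
    by (subst nn_integral_normal_law)
      (auto intro!: nn_integral_mono ennreal_leI simp flip: ennreal_mult' ennreal_plus)
  also have "\<dots> = ennreal (exp near + far)"
    using s nonneg by (simp add: nn_integral_add nn_integral_cmult nn_integral_normal_density)
  also have "\<dots> \<le> ennreal (exp (site_error L \<epsilon> s r))"
  proof (rule ennreal_leI)
    have "far \<le> exp near * far" using nonneg mult_right_mono[of 1 "exp near" far] by simp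
    then have "exp near + far \<le> exp near * (1 + far)" by (simp add: algebra_simps)
    also have "\<dots> \<le> exp near * exp far" by (intro mult_left_mono exp_ge_add_one_self) auto
    finally show "exp near + far \<le> exp (site_error L \<epsilon> s r)"
      by (simp add: site_error_def near_def far_def exp_add)
  qed
  finally show ?thesis .
qed

lemma summable_bigo_inverse_square:
  fixes f :: "nat \<Rightarrow> real"
  assumes "f \<in> O(\<lambda>n. 1 / real n ^ 2)"
  shows "summable f"
  using assms
proof (rule summable_comparison_test_bigo[rotated])
  show "summable (\<lambda>n. norm (1 / real n ^ 2))"
    using inverse_power_summable[of 2, where 'a=real] by (simp add: field_simps)
qed

lemma summable_exp_linear_minus_quadratic:
  assumes "c > 0"
  shows "summable (\<lambda>r. exp (L * real r - c * (real r)\<^sup>2))"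
  by (rule summable_bigo_inverse_square) (use assms in real_asymp)

lemma summable_site_error:
  assumes "s > 0" "\<epsilon> > 0"
  shows "summable (site_error L \<epsilon> s)"
proof -
  have "summable (\<lambda>n. L * real n * exp (- (\<epsilon> * real n / 2)))"
    by (rule summable_bigo_inverse_square) (use assms in real_asymp)
  moreover have "summable (\<lambda>n. exp (L * real n - (\<epsilon> * real n)\<^sup>2 / (32 * s\<^sup>2)))"
    using summable_exp_linear_minus_quadratic[of "\<epsilon>\<^sup>2 / (32 * s\<^sup>2)" L] assms
    by (simp add: power_mult_distrib)
  ultimately show ?thesis
    unfolding site_error_def[abs_def] by (intro summable_add summable_mult)
qed

section \<open>The ensemble of a split polynomial\<close>

definition spread :: "real \<Rightarrow> real" where
  "spread \<gamma> = \<gamma> / sqrt 2"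

definition site_mass :: "real \<Rightarrow> real \<Rightarrow> nat \<Rightarrow> real" where
  "site_mass R l m = 2 * pi * R * l * sqrt pi * exp ((real m * l / R)\<^sup>2)"

lemma site_mass_pos: "R > 0 \<Longrightarrow> l > 0 \<Longrightarrow> 0 < site_mass R l m"
  by (simp add: site_mass_def)

lemma normal_density_complete_square:
  fixes l R b \<sigma> t :: real
  assumes R: "R > 0" and l: "l > 0" and \<sigma>: "\<sigma> = 1 \<or> \<sigma> = - 1"
  shows "exp (2 * real m * (b + \<sigma> * t)) * exp (- ((R * (b + \<sigma> * t))\<^sup>2) / l\<^sup>2)
    = sqrt pi * (l / R) * exp ((real m * l / R)\<^sup>2)
      * normal_density (\<sigma> * (real m * (l / R)\<^sup>2 - b)) (spread (l / R)) t"
proof -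
  define \<gamma> where "\<gamma> = l / R"
  have \<gamma>: "\<gamma> > 0" "l = R * \<gamma>" using R l by (simp_all add: \<gamma>_def)
  have \<sigma>2: "\<sigma> * \<sigma> = 1" using \<sigma> by auto
  have "(t - \<sigma> * (real m * \<gamma>\<^sup>2 - b))\<^sup>2 = (\<sigma> * \<sigma>) * (b + \<sigma> * t - real m * \<gamma>\<^sup>2)\<^sup>2"
    using \<sigma> by (auto simp: power2_eq_square algebra_simps)
  then have shift: "(t - \<sigma> * (real m * \<gamma>\<^sup>2 - b))\<^sup>2 = (b + \<sigma> * t - real m * \<gamma>\<^sup>2)\<^sup>2"
    by (simp add: \<sigma>2)
  have "2 * real m * (b + \<sigma> * t) + - ((R * (b + \<sigma> * t))\<^sup>2) / l\<^sup>2
      = (real m * \<gamma>)\<^sup>2 + - ((t - \<sigma> * (real m * \<gamma>\<^sup>2 - b))\<^sup>2) / \<gamma>\<^sup>2"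
    unfolding shift \<gamma>(2) using R \<gamma>(1) by (simp add: field_simps power2_eq_square)
  then have "exp (2 * real m * (b + \<sigma> * t)) * exp (- ((R * (b + \<sigma> * t))\<^sup>2) / l\<^sup>2)
      = exp ((real m * \<gamma>)\<^sup>2) * exp (- ((t - \<sigma> * (real m * \<gamma>\<^sup>2 - b))\<^sup>2) / \<gamma>\<^sup>2)"
    by (simp only: exp_add[symmetric])
  moreover have "2 * (spread \<gamma>)\<^sup>2 = \<gamma>\<^sup>2"
    by (simp add: spread_def power_divide)
  moreover have "sqrt (2 * pi * (spread \<gamma>)\<^sup>2) = sqrt pi * \<gamma>"
    using \<gamma>(1) by (simp add: spread_def power_divide real_sqrt_mult)
  ultimately have "exp (2 * real m * (b + \<sigma> * t)) * exp (- ((R * (b + \<sigma> * t))\<^sup>2) / l\<^sup>2)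
      = sqrt pi * \<gamma> * exp ((real m * \<gamma>)\<^sup>2) * normal_density (\<sigma> * (real m * \<gamma>\<^sup>2 - b)) (spread \<gamma>) t"
    using \<gamma>(1) by (simp add: normal_density_def)
  then show ?thesis by (simp add: \<gamma>_def)
qed

lemma nn_integral_site:
  fixes \<phi> :: "real \<Rightarrow> ennreal"
  assumes [measurable]: "\<phi> \<in> borel_measurable borel"
    and R: "R > 0" and l: "l > 0" and \<sigma>: "\<sigma> = 1 \<or> \<sigma> = - 1"
  shows "(\<integral>\<^sup>+z. ennreal (exp (2 * real m * (Re z / R))) * ennreal (exp (- ((Re z)\<^sup>2) / l\<^sup>2))
      * \<phi> (\<sigma> * (Re z / R - b))
      \<partial>cyl_measure R)
    = ennreal (site_mass R l m)
      * (\<integral>\<^sup>+t. \<phi> t \<partial>normal_law (\<sigma> * (real m * (l / R)\<^sup>2 - b)) (spread (l / R)))"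
proof -
  define C where "C = sqrt pi * (l / R) * exp ((real m * l / R)\<^sup>2)"
  have C: "0 \<le> C" using R l by (simp add: C_def)
  let ?density = "normal_density (\<sigma> * (real m * (l / R)\<^sup>2 - b)) (spread (l / R))"
  define g where "g x
      = ennreal (exp (2 * real m * (x / R))) * ennreal (exp (- (x\<^sup>2) / l\<^sup>2)) * \<phi> (\<sigma> * (x / R - b))"
        for x
  have [measurable]: "g \<in> borel_measurable borel" unfolding g_def by measurable
  have g: "g (R * b + \<sigma> * R * t) = ennreal C * (ennreal (?density t) * \<phi> t)" for t
  proof -
    have "R * b + \<sigma> * R * t = R * (b + \<sigma> * t)" by (simp add: algebra_simps)
    moreover have "R * (b + \<sigma> * t) / R = b + \<sigma> * t" using R by simp
    moreover have "\<sigma> * (b + \<sigma> * t - b) = t" using \<sigma> by auto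
    ultimately have "g (R * b + \<sigma> * R * t)
        = ennreal (exp (2 * real m * (b + \<sigma> * t))) * ennreal (exp (- ((R * (b + \<sigma> * t))\<^sup>2) / l\<^sup>2))
            * \<phi> t"
      by (simp only: g_def)
    also have "\<dots> = ennreal (C * ?density t) * \<phi> t"
      unfolding C_def normal_density_complete_square[OF R l \<sigma>, of m b t, symmetric]
      by (subst ennreal_mult') simp_all
    also have "\<dots> = ennreal C * (ennreal (?density t) * \<phi> t)"
      using C by (subst ennreal_mult') (simp_all add: mult.assoc)
    finally show ?thesis .
  qed
  have "(\<integral>\<^sup>+z. g (Re z) \<partial>cyl_measure R) = ennreal (2 * pi * R) * (\<integral>\<^sup>+x. g x \<partial>lborel)"
    by (rule nn_integral_cyl_measure_Re[OF _ R]) measurable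
  also have "(\<integral>\<^sup>+x. g x \<partial>lborel) = ennreal \<bar>\<sigma> * R\<bar> * (\<integral>\<^sup>+t. g (R * b + \<sigma> * R * t) \<partial>lborel)"
    using R \<sigma> by (intro nn_integral_real_affine) auto
  also have "\<dots> = ennreal R * (ennreal C * (\<integral>\<^sup>+t. ennreal (?density t) * \<phi> t \<partial>lborel))"
    unfolding g using R \<sigma> by (subst nn_integral_cmult) auto
  also have "ennreal (2 * pi * R) * \<dots>
      = ennreal (2 * pi * R * (R * C)) * (\<integral>\<^sup>+t. ennreal (?density t) * \<phi> t \<partial>lborel)"
    using R C by (simp add: ennreal_mult mult.assoc)
  also have "2 * pi * R * (R * C) = site_mass R l m"
    using R by (simp add: site_mass_def C_def)
  finally show ?thesis by (simp add: g_def nn_integral_normal_law)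
qed

definition ordered_across :: "'i set \<Rightarrow> 'i set \<Rightarrow> ('i \<Rightarrow> real) set" where
  "ordered_across I J = {x. \<forall>i\<in>I. \<forall>j\<in>J. x i \<le> x j}"

definition separated_at :: "real \<Rightarrow> 'i set \<Rightarrow> 'i set \<Rightarrow> ('i \<Rightarrow> real) set" where
  "separated_at c I J = {x. (\<forall>i\<in>I. x i < c) \<and> (\<forall>j\<in>J. c < x j)}"

lemma ordered_across_measurable:
  assumes "finite I" "finite J" "I \<union> J \<subseteq> U"
  shows "(\<lambda>z. indicator (ordered_across I J) (Re \<circ> z) :: ennreal)
      \<in> borel_measurable (cyl_config R U)"
proof -
  have "indicator (ordered_across I J) x = (\<Prod>i\<in>I. \<Prod>j\<in>J. if x i \<le> x j then 1 else 0 :: ennreal)"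
    for x
    using assms by (auto simp: ordered_across_def indicator_def)
  moreover have [measurable (raw)]: "i \<in> I \<Longrightarrow> i \<in> U" "i \<in> J \<Longrightarrow> i \<in> U" for i
    using assms(3) by auto
  ultimately show ?thesis by simp
qed

lemma separated_at_measurable:
  assumes "finite I" "finite J" "I \<union> J \<subseteq> U"
  shows "(\<lambda>z. indicator (separated_at c I J) (Re \<circ> z) :: ennreal)
      \<in> borel_measurable (cyl_config R U)"
proof -
  have "(indicator (separated_at c I J) x :: ennreal)
      = (\<Prod>i\<in>I. indicator {..<c} (x i)) * (\<Prod>j\<in>J. indicator {c<..} (x j))" for x
    using assms by (auto simp: separated_at_def indicator_def)
  moreover have [measurable (raw)]: "i \<in> I \<Longrightarrow> i \<in> U" "i \<in> J \<Longrightarrow> i \<in> U" for i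
    using assms(3) by auto
  ultimately show ?thesis by simp
qed

definition label_decay :: "nat \<Rightarrow> real \<Rightarrow> real" where
  "label_decay p \<gamma> = real p * \<gamma>\<^sup>2 / 4"

text \<open>The rate \<open>L\<close> in \<open>interaction_le_site_weights\<close> for \<open>P = 2 p\<close> and \<open>\<eta> = 1 / (8 s\<^sup>2)\<close>, where \<open>s\<close>
  is the standard deviation of the sites: this \<open>\<eta>\<close> is small enough for the Gaussians to absorb
  \<open>exp (\<eta> y\<^sup>2)\<close>.\<close>

definition interaction_cost :: "nat \<Rightarrow> real \<Rightarrow> real" where
  "interaction_cost p \<gamma>
    = 2 * real p + (2 * real p)\<^sup>2 / (2 * (1 / (8 * (spread \<gamma>)\<^sup>2)) * (label_decay p \<gamma>)\<^sup>2)"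

definition upper_factor :: "nat \<Rightarrow> real \<Rightarrow> real" where
  "upper_factor p \<gamma>
    = exp (2 * suminf (site_error (interaction_cost p \<gamma>) (label_decay p \<gamma>) (spread \<gamma>)))"

definition lower_factor :: "nat \<Rightarrow> real \<Rightarrow> real" where
  "lower_factor p \<gamma>
    = exp (- (2 * (\<Sum>r. exp (- ((2 * label_decay p \<gamma> * real r)\<^sup>2 / (2 * (spread \<gamma>)\<^sup>2))))))"

definition comparison_factor :: "nat \<Rightarrow> real \<Rightarrow> real" where
  "comparison_factor p \<gamma> = upper_factor p \<gamma> / lower_factor p \<gamma>"

lemma comparison_factor_pos: "0 < comparison_factor p \<gamma>"
  by (simp add: comparison_factor_def upper_factor_def lower_factor_def)

locale cylinder_bipartition = bipartition p I J
  for p :: nat and I J :: "'i::linorder set" +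
  fixes R l :: real
  assumes p: "1 \<le> p" and R: "0 < R" and l: "0 < l"
begin

abbreviation \<gamma> :: real where "\<gamma> \<equiv> l / R"

lemma spread_pos: "0 < spread \<gamma>" and label_decay_pos: "0 < label_decay p \<gamma>"
  using p R l by (simp_all add: spread_def label_decay_def)

lemma interaction_cost_nonneg: "0 \<le> interaction_cost p \<gamma>"
  by (simp add: interaction_cost_def)

definition gauss :: "('i \<Rightarrow> real) \<Rightarrow> ennreal" where
  "gauss x = (\<Prod>i\<in>I \<union> J. ennreal (exp (- ((x i)\<^sup>2) / l\<^sup>2)))"

lemma gauss_measurable [measurable]:
  "(\<lambda>z. gauss (Re \<circ> z)) \<in> borel_measurable (cyl_config R (I \<union> J))"
  unfolding gauss_def comp_def by measurable

abbreviation ordered_gauss :: "('i \<Rightarrow> real) \<Rightarrow> ennreal" where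
  "ordered_gauss x \<equiv> gauss x * indicator (ordered_across I J) x"

abbreviation separated_gauss :: "('i \<Rightarrow> real) \<Rightarrow> ennreal" where
  "separated_gauss x \<equiv> gauss x * indicator (separated_at (cut * \<gamma>\<^sup>2 * R) I J) x"

abbreviation mass :: "(('i \<Rightarrow> real) \<Rightarrow> ennreal) \<Rightarrow> (('i \<Rightarrow> complex) \<Rightarrow> complex) \<Rightarrow> ennreal" where
  "mass \<equiv> cyl_norm_square R (I \<union> J)"

definition cut_coord :: "('i \<Rightarrow> real) \<Rightarrow> 'i \<Rightarrow> real" where
  "cut_coord x i = side i * (x i / R - cut * \<gamma>\<^sup>2)"

lemma cut_coord_add: "i \<in> I \<Longrightarrow> j \<in> J \<Longrightarrow> cut_coord x i + cut_coord x j = x i / R - x j / R"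
  using disjoint by (auto simp: cut_coord_def side_def)

abbreviation site_law :: "('i \<Rightarrow> nat) \<Rightarrow> 'i \<Rightarrow> real measure" where
  "site_law m i \<equiv> normal_law (side i * (real (m i) * \<gamma>\<^sup>2 - cut * \<gamma>\<^sup>2)) (spread \<gamma>)"

lemma site_law_mean_le:
  assumes "labelling m lab" "i \<in> I \<union> J"
  shows "side i * (real (m i) * \<gamma>\<^sup>2 - cut * \<gamma>\<^sup>2) \<le> - (2 * label_decay p \<gamma> * real (lab i))"
proof -
  have "real p / 2 * real (lab i) * \<gamma>\<^sup>2 \<le> side i * (cut - real (m i)) * \<gamma>\<^sup>2"
    using assms by (intro mult_right_mono) (auto simp: labelling_def)
  then show ?thesis by (simp add: label_decay_def algebra_simps)
qed

lemma mass_monomial: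
  fixes \<phi> :: "'i \<Rightarrow> real \<Rightarrow> ennreal"
  assumes [measurable]: "\<And>i. \<phi> i \<in> borel_measurable borel"
  shows "mass (\<lambda>x. gauss x * (\<Prod>i\<in>I \<union> J. \<phi> i (cut_coord x i))) (monomial (I \<union> J) m)
    = (\<Prod>i\<in>I \<union> J. ennreal (site_mass R l (m i))) * (\<Prod>i\<in>I \<union> J. \<integral>\<^sup>+t. \<phi> i t \<partial>site_law m i)"
proof -
  interpret product_sigma_finite "\<lambda>_. cyl_measure R" by (rule product_sigma_finite_cyl)
  have monomial: "ennreal ((cmod (monomial (I \<union> J) m (exp_coord R z)))\<^sup>2)
      = (\<Prod>i\<in>I \<union> J. ennreal (exp (2 * real (m i) * (Re (z i) / R))))" for z
  proof -
    have "(cmod (exp_coord R z i) ^ m i)\<^sup>2 = exp (2 * real (m i) * (Re (z i) / R))" for i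
      by (simp add: norm_exp_coord mult.assoc flip: exp_of_nat_mult exp_double)
    then show ?thesis
      by (simp add: monomial_def norm_power prod_ennreal prod_power_distrib flip: prod_norm)
  qed
  have "mass (\<lambda>x. gauss x * (\<Prod>i\<in>I \<union> J. \<phi> i (cut_coord x i))) (monomial (I \<union> J) m)
    = (\<integral>\<^sup>+z. (\<Prod>i\<in>I \<union> J. ennreal (exp (2 * real (m i) * (Re (z i) / R)))
        * ennreal (exp (- ((Re (z i))\<^sup>2) / l\<^sup>2))
        * \<phi> i (side i * (Re (z i) / R - cut * \<gamma>\<^sup>2))) \<partial>cyl_config R (I \<union> J))"
    by (simp add: cyl_norm_square_def monomial gauss_def cut_coord_def prod.distrib mult.assoc)
  also have "\<dots>
      = (\<Prod>i\<in>I \<union> J. \<integral>\<^sup>+z. ennreal (exp (2 * real (m i) * (Re z / R)))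
          * ennreal (exp (- ((Re z)\<^sup>2) / l\<^sup>2))
        * \<phi> i (side i * (Re z / R - cut * \<gamma>\<^sup>2)) \<partial>cyl_measure R)"
    using finite_parts by (intro product_nn_integral_prod measurable_cyl_measure_borel) auto
  also have "\<dots> = (\<Prod>i\<in>I \<union> J. ennreal (site_mass R l (m i)) * (\<integral>\<^sup>+t. \<phi> i t \<partial>site_law m i))"
    using R l by (intro prod.cong refl nn_integral_site) (auto simp: side_def)
  finally show ?thesis by (simp add: prod.distrib)
qed

lemma mass_monomial_gauss:
  "mass gauss (monomial (I \<union> J) m) = (\<Prod>i\<in>I \<union> J. ennreal (site_mass R l (m i)))"
  using mass_monomial[of "\<lambda>_ _. 1" m]
    prob_space.emeasure_space_1[OF prob_space_normal_law[OF spread_pos]]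
  by simp

definition interaction :: "('i \<Rightarrow> real) \<Rightarrow> real" where
  "interaction x = exp (2 * real p * (\<Sum>i\<in>I. \<Sum>j\<in>J. exp (cut_coord x i + cut_coord x j)))"

lemma interaction_measurable:
  "(\<lambda>z. interaction (Re \<circ> z)) \<in> borel_measurable (cyl_config R (I \<union> J))"
proof -
  have [measurable (raw)]: "i \<in> I \<Longrightarrow> i \<in> I \<union> J" "i \<in> J \<Longrightarrow> i \<in> I \<union> J" for i by auto
  show ?thesis unfolding interaction_def cut_coord_def comp_def by measurable
qed

lemma interaction_le_prod_site_weight:
  assumes lab: "labelling m lab" and x: "x \<in> ordered_across I J"
  shows "interaction x
    \<le> (\<Prod>i\<in>I \<union> J. site_weight (interaction_cost p \<gamma>) (label_decay p \<gamma>)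
        (1 / (8 * (spread \<gamma>)\<^sup>2)) (lab i) (cut_coord x i))"
  unfolding interaction_def
proof (rule interaction_le_site_weights[OF finite_parts disjoint])
  have bij: "bij_betw lab I {1..card I}" "bij_betw lab J {1..card J}"
    using lab by (auto simp: labelling_def)
  then show "inj_on lab I" "inj_on lab J" by (auto simp: bij_betw_def)
  show "1 \<le> lab i" if "i \<in> I \<union> J" for i
    using that bij[THEN bij_betwE] by auto
  show "cut_coord x i + cut_coord x j \<le> 0" if "i \<in> I" "j \<in> J" for i j
    using x that R by (simp add: cut_coord_add ordered_across_def divide_right_mono)
qed (use spread_pos label_decay_pos in \<open>auto simp: interaction_cost_def\<close>)

lemma mass_monomial_interaction_le:
  assumes m: "m \<in> split_exponents"
  shows "mass (\<lambda>x. ordered_gauss x * ennreal (interaction x)) (monomial (I \<union> J) m)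
    \<le> ennreal (upper_factor p \<gamma>) * mass gauss (monomial (I \<union> J) m)"
proof -
  obtain lab where lab: "labelling m lab" using labelling_exists[OF m] by blast
  let ?L = "interaction_cost p \<gamma>" and ?\<epsilon> = "label_decay p \<gamma>" and ?s = "spread \<gamma>"
  define \<phi> where "\<phi> i t = ennreal (site_weight ?L ?\<epsilon> (1 / (8 * ?s\<^sup>2)) (lab i) t)" for i t
  have pointwise: "indicator (ordered_across I J) x * ennreal (interaction x)
      \<le> (\<Prod>i\<in>I \<union> J. \<phi> i (cut_coord x i))" for x
    using interaction_le_prod_site_weight[OF lab, of x]
    by (auto simp: \<phi>_def indicator_def prod_ennreal site_weight_nonneg intro: ennreal_leI)
  have "(\<Prod>i\<in>I \<union> J. \<integral>\<^sup>+t. \<phi> i t \<partial>site_law m i)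
      \<le> (\<Prod>i\<in>I \<union> J. ennreal (exp (site_error ?L ?\<epsilon> ?s (lab i))))"
    unfolding \<phi>_def using site_law_mean_le[OF lab] label_decay_pos
    by (intro prod_mono_ennreal nn_integral_site_weight_le spread_pos interaction_cost_nonneg) auto
  also have "\<dots> = ennreal (exp (\<Sum>i\<in>I \<union> J. site_error ?L ?\<epsilon> ?s (lab i)))"
    using finite_parts by (simp add: prod_ennreal exp_sum)
  also have "\<dots> \<le> ennreal (upper_factor p \<gamma>)"
    using labelling_sum_le[OF lab summable_site_error[OF spread_pos label_decay_pos], of ?L]
      interaction_cost_nonneg
    by (intro ennreal_leI) (simp add: site_error_nonneg upper_factor_def)
  finally have factor: "(\<Prod>i\<in>I \<union> J. \<integral>\<^sup>+t. \<phi> i t \<partial>site_law m i) \<le> ennreal (upper_factor p \<gamma>)" .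
  have "mass (\<lambda>x. ordered_gauss x * ennreal (interaction x)) (monomial (I \<union> J) m)
      \<le> mass (\<lambda>x. gauss x * (\<Prod>i\<in>I \<union> J. \<phi> i (cut_coord x i))) (monomial (I \<union> J) m)"
    unfolding cyl_norm_square_def mult.assoc using pointwise
    by (intro nn_integral_mono mult_left_mono) auto
  also have "\<dots> = (\<Prod>i\<in>I \<union> J. ennreal (site_mass R l (m i))) * (\<Prod>i\<in>I \<union> J. \<integral>\<^sup>+t. \<phi> i t \<partial>site_law m i)"
    by (rule mass_monomial) (simp add: \<phi>_def)
  also have "\<dots> \<le> (\<Prod>i\<in>I \<union> J. ennreal (site_mass R l (m i))) * ennreal (upper_factor p \<gamma>)"
    using factor by (rule mult_left_mono) simp
  finally show ?thesis by (simp add: mass_monomial_gauss mult.commute)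
qed

lemma indicator_separated_at:
  "indicator (separated_at (cut * \<gamma>\<^sup>2 * R) I J) x
      = (\<Prod>i\<in>I \<union> J. indicator {..<0} (cut_coord x i) :: ennreal)"
proof -
  have "x \<in> separated_at (cut * \<gamma>\<^sup>2 * R) I J \<longleftrightarrow> (\<forall>i\<in>I \<union> J. cut_coord x i < 0)"
    using R disjoint
    by (auto simp: separated_at_def cut_coord_def side_def pos_divide_less_eq pos_less_divide_eq)
  then show ?thesis using finite_parts by (auto simp: indicator_def)
qed

lemma mass_monomial_separated_ge:
  assumes m: "m \<in> split_exponents"
  shows "ennreal (lower_factor p \<gamma>) * mass gauss (monomial (I \<union> J) m)
    \<le> mass separated_gauss (monomial (I \<union> J) m)"
proof -
  obtain lab where lab: "labelling m lab" using labelling_exists[OF m] by blast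
  define tail where "tail r = exp (- ((2 * label_decay p \<gamma> * real r)\<^sup>2 / (2 * (spread \<gamma>)\<^sup>2)))"
    for r :: nat
  have "summable tail"
    using summable_exp_linear_minus_quadratic[of "(2 * label_decay p \<gamma>)\<^sup>2 / (2 * (spread \<gamma>)\<^sup>2)" 0]
      spread_pos label_decay_pos
    by (simp add: tail_def[abs_def] power_mult_distrib mult_ac)
  moreover have "0 \<le> tail r" for r by (simp add: tail_def)
  ultimately have "(\<Sum>i\<in>I \<union> J. tail (lab i)) \<le> 2 * suminf tail"
    by (rule labelling_sum_le[OF lab])
  then have "ennreal (lower_factor p \<gamma>) \<le> ennreal (exp (\<Sum>i\<in>I \<union> J. - tail (lab i)))"
    unfolding lower_factor_def tail_def[symmetric] by (intro ennreal_leI) (simp add: sum_negf)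
  also have "\<dots> = (\<Prod>i\<in>I \<union> J. ennreal (exp (- tail (lab i))))"
    using finite_parts by (simp add: prod_ennreal exp_sum)
  also have "\<dots> \<le> (\<Prod>i\<in>I \<union> J. \<integral>\<^sup>+t. indicator {..<0} t \<partial>site_law m i)"
    unfolding tail_def using site_law_mean_le[OF lab] label_decay_pos
    by (intro prod_mono_ennreal) (simp add: emeasure_normal_law_neg_ge[OF spread_pos])
  finally have "ennreal (lower_factor p \<gamma>) * (\<Prod>i\<in>I \<union> J. ennreal (site_mass R l (m i)))
      \<le> (\<Prod>i\<in>I \<union> J. ennreal (site_mass R l (m i)))
          * (\<Prod>i\<in>I \<union> J. \<integral>\<^sup>+t. indicator {..<0} t \<partial>site_law m i)"
    by (subst mult.commute) (rule mult_left_mono, simp_all)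
  then show ?thesis
    unfolding mass_monomial_gauss indicator_separated_at
    by (subst mass_monomial) auto
qed

abbreviation split_mass :: ennreal where
  "split_mass \<equiv> mass gauss split_poly"

lemmas split_poly_measurable = monomial_span_measurable[OF split_poly_in_span]

lemma split_mass_finite: "split_mass < \<infinity>"
proof (rule cyl_norm_square_monomial_span_finite[OF _ R split_poly_in_span split_exponents_support
  gauss_measurable])
  show "mass gauss (monomial (I \<union> J) m) < \<infinity>" for m
    unfolding mass_monomial_gauss by (simp add: ennreal_prod_eq_top less_top[symmetric])
qed (use finite_parts in auto)

lemma split_mass_pos: "0 < split_mass"
proof -
  obtain f :: "'i \<Rightarrow> nat" where "inj_on f (I \<union> J)"
    using finite_imp_inj_to_nat_seg[of "I \<union> J"] finite_parts by auto
  then have "split_poly (\<lambda>i. of_nat (Suc (f i))) \<noteq> 0"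
    by (intro split_poly_nonzero) (auto simp: inj_on_def simp del: of_nat_Suc)
  then show ?thesis
  proof (rule cyl_norm_square_monomial_span_pos[OF _ R split_poly_in_span split_exponents_support
    gauss_measurable, rotated])
    show "0 < mass gauss (monomial (I \<union> J) m)" for m
      unfolding mass_monomial_gauss
      using finite_parts site_mass_pos[OF R l] by (simp add: prod_ennreal less_imp_le prod_pos)
  qed (use finite_parts in auto)
qed

lemma mass_ordered_le:
  "mass ordered_gauss full_poly \<le> ennreal (upper_factor p \<gamma>) * split_mass"
proof -
  note [measurable] = interaction_measurable ordered_across_measurable[OF finite_parts order.refl]
  have "(cmod (full_poly (exp_coord R z)))\<^sup>2
      \<le> (cmod (split_poly (exp_coord R z)))\<^sup>2 * interaction (Re \<circ> z)" for z
    using edge_prod_le_split_poly[of "exp_coord R z"]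
    by (simp add: interaction_def cut_coord_add norm_exp_coord exp_diff) (simp add: exp_coord_def)
  then have "mass ordered_gauss full_poly
      \<le> mass (\<lambda>x. ordered_gauss x * ennreal (interaction x)) split_poly"
    unfolding cyl_norm_square_def
    by (intro nn_integral_mono)
      (auto simp: interaction_def mult_ac simp flip: ennreal_mult'
        intro!: mult_left_mono ennreal_leI split: split_indicator)
  also have "\<dots> \<le> mass (\<lambda>x. ennreal (upper_factor p \<gamma>) * gauss x) split_poly"
  proof (rule cyl_norm_square_monomial_span_mono[OF _ R split_poly_in_span split_exponents_support])
    fix m assume "m \<in> split_exponents"
    then show "mass (\<lambda>x. ordered_gauss x * ennreal (interaction x)) (monomial (I \<union> J) m)
        \<le> mass (\<lambda>x. ennreal (upper_factor p \<gamma>) * gauss x) (monomial (I \<union> J) m)"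
      by (simp add: cyl_norm_square_cmult gauss_measurable monomial_measurable
        mass_monomial_interaction_le)
  qed (use finite_parts in auto)
  also have "\<dots> = ennreal (upper_factor p \<gamma>) * split_mass"
    by (rule cyl_norm_square_cmult[OF split_poly_measurable gauss_measurable])
  finally show ?thesis .
qed

lemma mass_separated_ge:
  "ennreal (lower_factor p \<gamma>) * split_mass \<le> mass separated_gauss full_poly"
proof -
  note [measurable] = separated_at_measurable[OF finite_parts order.refl]
  have "ennreal (lower_factor p \<gamma>) * split_mass
      = mass (\<lambda>x. ennreal (lower_factor p \<gamma>) * gauss x) split_poly"
    by (rule cyl_norm_square_cmult[OF split_poly_measurable gauss_measurable, symmetric])
  also have "\<dots> \<le> mass separated_gauss split_poly"
  proof (rule cyl_norm_square_monomial_span_mono[OF _ R split_poly_in_span split_exponents_support])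
    fix m assume "m \<in> split_exponents"
    then show "mass (\<lambda>x. ennreal (lower_factor p \<gamma>) * gauss x) (monomial (I \<union> J) m)
        \<le> mass separated_gauss (monomial (I \<union> J) m)"
      by (simp add: cyl_norm_square_cmult gauss_measurable monomial_measurable
        mass_monomial_separated_ge)
  qed (use finite_parts in auto)
  also have "\<dots> \<le> mass separated_gauss full_poly"
    by (rule cyl_norm_square_split_poly_le[OF R]) measurable
  finally show ?thesis .
qed

lemma mass_ordered_le_separated:
  "mass ordered_gauss full_poly \<le> ennreal (comparison_factor p \<gamma>) * mass separated_gauss full_poly"
proof -
  have "ennreal (upper_factor p \<gamma>) * split_mass
      = ennreal (comparison_factor p \<gamma>) * (ennreal (lower_factor p \<gamma>) * split_mass)"
    by (simp add: comparison_factor_def upper_factor_def lower_factor_def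
      flip: mult.assoc ennreal_mult)
  then show ?thesis
    using mass_ordered_le mult_left_mono[OF mass_separated_ge zero_le]
    by (simp only:) (rule order.trans)
qed

lemma mass_ordered_finite: "mass ordered_gauss full_poly < \<infinity>"
  using mass_ordered_le split_mass_finite by (simp add: ennreal_mult_less_top order.strict_trans1)

lemma mass_separated_pos: "0 < mass separated_gauss full_poly"
proof -
  have "0 < ennreal (lower_factor p \<gamma>) * split_mass"
    using split_mass_pos by (simp add: ennreal_zero_less_mult_iff lower_factor_def)
  then show ?thesis using mass_separated_ge by (rule order.strict_trans2)
qed

end

section \<open>The probability of zero excess\<close>

lemma laughlin_Psi_norm_square:
  "ennreal ((cmod (laughlin_Psi p R l N z))\<^sup>2)
    = ennreal ((cmod (edge_prod p (ordered_pairs {..<N}) (exp_coord R z)))\<^sup>2)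
      * (\<Prod>i<N. ennreal (exp (- ((Re (z i))\<^sup>2) / l\<^sup>2)))"
proof -
  have "(\<Prod>k<N. \<Prod>j<k. (exp_coord R z k - exp_coord R z j) ^ p)
      = (\<Prod>(k, j)\<in>Sigma {..<N} (\<lambda>k. {..<k}). (exp_coord R z k - exp_coord R z j) ^ p)"
    by (subst prod.Sigma) auto
  also have "\<dots> = edge_prod p (ordered_pairs {..<N}) (exp_coord R z)"
    unfolding edge_prod_def
    by (rule prod.reindex_bij_witness[of _ "\<lambda>(i, j). (j, i)" "\<lambda>(i, j). (j, i)"])
       (auto simp: ordered_pairs_def)
  finally have poly: "(\<Prod>k<N. \<Prod>j<k. (exp (z k / of_real R) - exp (z j / of_real R)) ^ p)
      = edge_prod p (ordered_pairs {..<N}) (exp_coord R z)"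
    by (simp add: exp_coord_def)
  have "2 * (- (1 / (2 * l\<^sup>2)) * (\<Sum>k<N. (Re (z k))\<^sup>2)) = (\<Sum>i<N. - ((Re (z i))\<^sup>2) / l\<^sup>2)"
    by (simp add: sum_negf flip: sum_divide_distrib)
  then have "(exp (- (1 / (2 * l\<^sup>2)) * (\<Sum>k<N. (Re (z k))\<^sup>2)))\<^sup>2
      = (\<Prod>i<N. exp (- ((Re (z i))\<^sup>2) / l\<^sup>2))"
    by (simp only: exp_sum[OF finite_lessThan, symmetric] exp_double[symmetric])
  then show ?thesis
    unfolding laughlin_Psi_def poly
    by (simp only: norm_mult power_mult_distrib norm_of_real abs_exp_cancel)
       (simp add: ennreal_mult prod_nonneg prod_ennreal)
qed

lemma ordered_initial_subset_exists:
  fixes f :: "'i \<Rightarrow> real"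
  assumes "finite U" "k \<le> card U"
  shows "\<exists>I\<subseteq>U. card I = k \<and> (\<forall>i\<in>I. \<forall>j\<in>U - I. f i \<le> f j)"
  using assms(2)
proof (induction k)
  case 0
  then show ?case by (intro exI[of _ "{}"]) auto
next
  case (Suc k)
  then obtain I where I: "I \<subseteq> U" "card I = k" "\<forall>i\<in>I. \<forall>j\<in>U - I. f i \<le> f j" by auto
  then have "U - I \<noteq> {}" using Suc.prems
    by (metis Diff_eq_empty_iff Suc_n_not_le_n subset_antisym)
  then have "\<exists>x\<in>U - I. \<forall>y\<in>U - I. f x \<le> f y"
    using arg_min_if_finite[of "U - I" f] assms(1) by (metis finite_Diff not_le)
  then obtain x where x: "x \<in> U - I" "\<forall>y\<in>U - I. f x \<le> f y" by blast
  then show ?case using I finite_subset[OF I(1) assms(1)]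
    by (intro exI[of _ "insert x I"]) auto
qed

lemma emeasure_normalized_density_ge:
  fixes Q :: "'a \<Rightarrow> ennreal"
  assumes [measurable]: "Q \<in> borel_measurable M" "A \<in> sets M" and c: "0 < c"
    and total: "0 < (\<integral>\<^sup>+x. Q x \<partial>M)" "(\<integral>\<^sup>+x. Q x \<partial>M) < \<infinity>"
    and le: "(\<integral>\<^sup>+x. Q x \<partial>M) \<le> ennreal c * (\<integral>\<^sup>+x. Q x * indicator A x \<partial>M)"
  shows "ennreal (1 / c) \<le> emeasure (density M (\<lambda>x. Q x / (\<integral>\<^sup>+x. Q x \<partial>M))) A"
proof -
  define Z where "Z = (\<integral>\<^sup>+x. Q x \<partial>M)"
  define W where "W = (\<integral>\<^sup>+x. Q x * indicator A x \<partial>M)"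
  have "ennreal (1 / c) = ennreal (1 / c) * Z / Z"
    using total by (simp add: Z_def ennreal_mult_divide_eq)
  also have "\<dots> \<le> ennreal (1 / c) * (ennreal c * W) / Z"
    using le by (intro divide_right_mono_ennreal mult_left_mono) (auto simp: Z_def W_def)
  also have "\<dots> = W / Z"
    using c by (simp flip: mult.assoc ennreal_mult)
  also have "\<dots> = (\<integral>\<^sup>+x. Q x * indicator A x / Z \<partial>M)"
    unfolding W_def by (rule nn_integral_divide[symmetric]) measurable
  also have "\<dots> = (\<integral>\<^sup>+x. Q x / Z * indicator A x \<partial>M)"
    by (simp add: divide_ennreal_def mult_ac)
  also have "\<dots> = emeasure (density M (\<lambda>x. Q x / Z)) A"
    by (rule emeasure_density[symmetric]) measurable
  finally show ?thesis unfolding Z_def .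
qed

locale laughlin_ensemble =
  fixes p N k :: nat and R l :: real
  assumes p: "1 \<le> p" and R: "0 < R" and l: "0 < l" and k: "1 \<le> k" "k < N"
begin

abbreviation config :: "(nat \<Rightarrow> complex) measure" where
  "config \<equiv> config_measure R N"

definition weight :: "(nat \<Rightarrow> complex) \<Rightarrow> ennreal" where
  "weight z = ennreal ((cmod (laughlin_Psi p R l N z))\<^sup>2)"

definition xbar :: real where
  "xbar = (real k - 1 / 2) * real p * l\<^sup>2 / R"

definition left_sets :: "nat set set" where
  "left_sets = {I. I \<subseteq> {..<N} \<and> card I = k}"

abbreviation ordered :: "nat set \<Rightarrow> (nat \<Rightarrow> real) set" where
  "ordered I \<equiv> ordered_across I ({..<N} - I)"

abbreviation separated :: "nat set \<Rightarrow> (nat \<Rightarrow> real) set" where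
  "separated I \<equiv> separated_at xbar I ({..<N} - I)"

abbreviation partition_function :: ennreal where
  "partition_function \<equiv> \<integral>\<^sup>+z. weight z \<partial>config"

abbreviation ordered_weight :: "nat set \<Rightarrow> ennreal" where
  "ordered_weight I \<equiv> \<integral>\<^sup>+z. weight z * indicator (ordered I) (Re \<circ> z) \<partial>config"

abbreviation separated_weight :: "nat set \<Rightarrow> ennreal" where
  "separated_weight I \<equiv> \<integral>\<^sup>+z. weight z * indicator (separated I) (Re \<circ> z) \<partial>config"

definition zero_excess :: "(nat \<Rightarrow> complex) set" where
  "zero_excess = {z \<in> space config. particle_excess N k xbar z = 0}"

lemma finite_left_sets: "finite left_sets"
  unfolding left_sets_def by (rule finite_subset[of _ "Pow {..<N}"]) auto

lemma left_sets_bipartition: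
  assumes "I \<in> left_sets"
  shows "cylinder_bipartition p I ({..<N} - I) R l"
  using assms p R l by unfold_locales (auto simp: left_sets_def intro: finite_subset)

lemma weight_measurable [measurable]: "weight \<in> borel_measurable config"
proof -
  note [measurable] = edge_prod_measurable[OF ordered_pairs_subset]
  show ?thesis unfolding weight_def laughlin_Psi_norm_square config_measure_def by measurable
qed

lemma ordered_measurable [measurable]:
  assumes "I \<in> left_sets"
  shows "(\<lambda>z. indicator (ordered I) (Re \<circ> z) :: ennreal) \<in> borel_measurable config"
  unfolding config_measure_def using assms
  by (intro ordered_across_measurable) (auto simp: left_sets_def intro: finite_subset)

lemma separated_measurable [measurable]:
  assumes "I \<in> left_sets"
  shows "(\<lambda>z. indicator (separated I) (Re \<circ> z) :: ennreal) \<in> borel_measurable config"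
  unfolding config_measure_def using assms
  by (intro separated_at_measurable) (auto simp: left_sets_def intro: finite_subset)

lemma zero_excess_measurable [measurable]: "zero_excess \<in> sets config"
proof -
  have "particle_excess N k xbar z = 0 \<longleftrightarrow> (\<Sum>j<N. if Re (z j) \<le> xbar then 1 else 0) = real k" for z
    by (simp add: particle_excess_def sum.If_cases Int_def)
  then show ?thesis unfolding zero_excess_def config_measure_def by simp
qed

lemma
  assumes I: "I \<in> left_sets"
  shows ordered_weight_le_separated:
      "ordered_weight I \<le> ennreal (comparison_factor p (l / R)) * separated_weight I"
    and ordered_weight_finite: "ordered_weight I < \<infinity>"
    and separated_weight_pos: "0 < separated_weight I"
proof -
  interpret cylinder_bipartition p I "{..<N} - I" R l using I by (rule left_sets_bipartition)
  have union: "I \<union> ({..<N} - I) = {..<N}" using I by (auto simp: left_sets_def)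
  have norm: "(\<integral>\<^sup>+z. weight z * h (Re \<circ> z) \<partial>config) = mass (\<lambda>x. gauss x * h x) full_poly" for h
    unfolding cyl_norm_square_def gauss_def union weight_def laughlin_Psi_norm_square
      config_measure_def
    by (simp add: mult.assoc)
  have xbar: "xbar = cut * (l / R)\<^sup>2 * R"
    using I R by (simp add: xbar_def cut_def left_sets_def power_divide power2_eq_square)
  show "ordered_weight I \<le> ennreal (comparison_factor p (l / R)) * separated_weight I"
    and "ordered_weight I < \<infinity>"
    and "0 < separated_weight I"
    unfolding norm xbar
    by (rule mass_ordered_le_separated mass_ordered_finite mass_separated_pos)+
qed

lemma partition_function_le_ordered:
  "partition_function \<le> (\<Sum>I\<in>left_sets. ordered_weight I)"
proof -
  have "partition_function
      \<le> (\<integral>\<^sup>+z. (\<Sum>I\<in>left_sets. weight z * indicator (ordered I) (Re \<circ> z)) \<partial>config)"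
  proof (rule nn_integral_mono)
    fix z :: "nat \<Rightarrow> complex"
    have "k \<le> card {..<N}" using k by simp
    from ordered_initial_subset_exists[OF finite_lessThan this, of "Re \<circ> z"]
    obtain I where "I \<subseteq> {..<N}" "card I = k" "\<forall>i\<in>I. \<forall>j\<in>{..<N} - I. (Re \<circ> z) i \<le> (Re \<circ> z) j"
      by blast
    then have I: "I \<in> left_sets" "Re \<circ> z \<in> ordered I"
      by (simp_all add: left_sets_def ordered_across_def)
    then have "weight z = weight z * indicator (ordered I) (Re \<circ> z)" by simp
    also have "\<dots> \<le> (\<Sum>I\<in>left_sets. weight z * indicator (ordered I) (Re \<circ> z))"
      using I finite_left_sets by (intro member_le_sum) auto
    finally show "weight z \<le> (\<Sum>I\<in>left_sets. weight z * indicator (ordered I) (Re \<circ> z))" .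
  qed
  also have "\<dots> = (\<Sum>I\<in>left_sets. ordered_weight I)"
    by (rule nn_integral_sum) measurable
  finally show ?thesis .
qed

lemma separated_imp_zero_excess:
  assumes I: "I \<in> left_sets" and z: "z \<in> space config" "Re \<circ> z \<in> separated I"
  shows "I = {j \<in> {..<N}. Re (z j) \<le> xbar}" and "z \<in> zero_excess"
proof -
  have left: "\<And>i. i \<in> I \<Longrightarrow> Re (z i) < xbar" and right: "\<And>j. j < N \<Longrightarrow> j \<notin> I \<Longrightarrow> xbar < Re (z j)"
    using z(2) by (auto simp: separated_at_def)
  show eq: "I = {j \<in> {..<N}. Re (z j) \<le> xbar}"
  proof (rule set_eqI)
    fix j
    show "j \<in> I \<longleftrightarrow> j \<in> {j \<in> {..<N}. Re (z j) \<le> xbar}"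
      using left[of j] right[of j] I by (cases "j \<in> I") (auto simp: left_sets_def)
  qed
  have "particle_excess N k xbar z = 0"
    using I unfolding particle_excess_def eq[symmetric] by (simp add: left_sets_def)
  then show "z \<in> zero_excess"
    using z(1) by (simp add: zero_excess_def)
qed

lemma separated_weight_le_zero_excess:
  "(\<Sum>I\<in>left_sets. separated_weight I) \<le> (\<integral>\<^sup>+z. weight z * indicator zero_excess z \<partial>config)"
proof -
  have "(\<Sum>I\<in>left_sets. separated_weight I)
      = (\<integral>\<^sup>+z. (\<Sum>I\<in>left_sets. weight z * indicator (separated I) (Re \<circ> z)) \<partial>config)"
    by (rule nn_integral_sum[symmetric]) measurable
  also have "\<dots> \<le> (\<integral>\<^sup>+z. weight z * indicator zero_excess z \<partial>config)"
  proof (rule nn_integral_mono)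
    fix z assume z: "z \<in> space config"
    let ?I = "{j \<in> {..<N}. Re (z j) \<le> xbar}"
    have "weight z * indicator (separated I) (Re \<circ> z)
        \<le> (if I = ?I then weight z * indicator zero_excess z else 0)"
      if "I \<in> left_sets" for I
    proof (cases "Re \<circ> z \<in> separated I")
      case True
      show ?thesis using separated_imp_zero_excess[OF that z True] by (simp split: split_indicator)
    qed simp
    then have "(\<Sum>I\<in>left_sets. weight z * indicator (separated I) (Re \<circ> z))
        \<le> (\<Sum>I\<in>left_sets. if I = ?I then weight z * indicator zero_excess z else 0)"
      by (rule sum_mono)
    also have "\<dots> \<le> weight z * indicator zero_excess z"
      using finite_left_sets by (simp add: sum.delta)
    finally show "(\<Sum>I\<in>left_sets. weight z * indicator (separated I) (Re \<circ> z))
        \<le> weight z * indicator zero_excess z" .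
  qed
  finally show ?thesis .
qed

lemma partition_function_le_zero_excess:
  "partition_function
    \<le> ennreal (comparison_factor p (l / R)) * (\<integral>\<^sup>+z. weight z * indicator zero_excess z \<partial>config)"
proof -
  let ?c = "ennreal (comparison_factor p (l / R))"
  have "partition_function \<le> (\<Sum>I\<in>left_sets. ordered_weight I)"
    by (rule partition_function_le_ordered)
  also have "\<dots> \<le> (\<Sum>I\<in>left_sets. ?c * separated_weight I)"
    by (intro sum_mono ordered_weight_le_separated)
  also have "\<dots> \<le> ?c * (\<integral>\<^sup>+z. weight z * indicator zero_excess z \<partial>config)"
    unfolding sum_distrib_left[symmetric]
    by (intro mult_left_mono separated_weight_le_zero_excess) simp
  finally show ?thesis .
qed

lemma partition_function_finite: "partition_function < \<infinity>"
  using partition_function_le_ordered ordered_weight_finite finite_left_sets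
  by (auto intro: order.strict_trans1)

lemma partition_function_pos: "0 < partition_function"
proof -
  have "{..<k} \<in> left_sets" using k by (auto simp: left_sets_def)
  then have "0 < separated_weight {..<k}"
    by (rule separated_weight_pos)
  also have "\<dots> \<le> partition_function"
    by (intro nn_integral_mono) (simp split: split_indicator)
  finally show ?thesis .
qed

lemma prob_zero_excess_ge:
  "ennreal (1 / comparison_factor p (l / R)) \<le> emeasure (laughlin_prob p R l N) zero_excess"
  unfolding laughlin_prob_def weight_def[symmetric]
  by (rule emeasure_normalized_density_ge[OF weight_measurable zero_excess_measurable _
        partition_function_pos partition_function_finite partition_function_le_zero_excess])
    (rule comparison_factor_pos)

end

theorem theorem5p3:
  fixes p :: nat and \<gamma> :: real
  assumes "p \<ge> 1" and "\<gamma> > 0"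
  shows "\<exists>c::real. 0 < c \<and>
           (\<forall>R l N k. R > 0 \<longrightarrow> l > 0 \<longrightarrow> l / R = \<gamma> \<longrightarrow> N \<ge> 2 \<longrightarrow> 1 \<le> k \<longrightarrow> k \<le> N - 1 \<longrightarrow>
              (let xbar = (real k - 1/2) * real p * l\<^sup>2 / R in
               emeasure (laughlin_prob p R l N)
                 {z \<in> space (laughlin_prob p R l N). particle_excess N k xbar z = 0}
               \<ge> ennreal (1 / c)))"
proof (intro exI conjI allI impI)
  show "0 < comparison_factor p \<gamma>"
    by (rule comparison_factor_pos)
  fix R l :: real and N k :: nat
  assume R: "R > 0" and l: "l > 0" and \<gamma>: "l / R = \<gamma>" and k: "N \<ge> 2" "1 \<le> k" "k \<le> N - 1"
  interpret laughlin_ensemble p N k R l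
    using assms(1) R l k by unfold_locales auto
  show "let xbar = (real k - 1/2) * real p * l\<^sup>2 / R in
      emeasure (laughlin_prob p R l N)
        {z \<in> space (laughlin_prob p R l N). particle_excess N k xbar z = 0}
      \<ge> ennreal (1 / comparison_factor p \<gamma>)"
    using prob_zero_excess_ge by (simp add: \<gamma> zero_excess_def xbar_def laughlin_prob_def)
qed

end
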